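(* Let $c>1$. The indeterminate symmetric Hamburger moment problem with $a_n=0$ for all $n\ge0$ and $b_n=n^c$ for $n\ge1$ (with $b_0>0$ arbitrary) has order $1/c$ and type $T_c/2$, where $T_c$ is the common type of the entire functions $$G_{2c}(z)=\sum_{n=1}^\infty\gamma_n(2c)z^n\quad\text{and}\quad Z_{2c}(z)=\sum_{n=2}^\infty\zeta_n(2c)z^n.$$ Here, for real $p>2$, $$\gamma_n(p)=\sum_{1\le k_1\le k_2<k_3\le k_4<\dots<k_{2n-1}\le k_{2n}}(k_1k_2\cdots k_{2n})^{-p/2},\quad n\ge1,$$ $$\zeta_n(p)=\sum_{1\le k_1<k_2<\dots<k_n}(k_2-k_1)(k_3-k_2)\cdots(k_n-k_{n-1})(k_1k_2\cdots k_n)^{-p},\quad n\ge2.$$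
   Context: All summation indices are positive integers. In $\gamma_n(p)$ the inequalities alternate: $k_{2j-1}\le k_{2j}$ and $k_{2j}<k_{2j+1}$. A (normalized) Hamburger moment problem is described by its Jacobi parameters $(a_n)_{n\ge0}$ (real) and $(b_n)_{n\ge0}$ (positive). The orthonormal polynomials $P_n$ and the polynomials of the second kind $Q_n$ both satisfy $z r_n(z)=b_nr_{n+1}(z)+a_nr_n(z)+b_{n-1}r_{n-1}(z)$ for $n\ge0$, with $b_{-1}:=1$, $P_{-1}=0$, $P_0=1$, $Q_{-1}=-1$, $Q_0=0$. The problem is symmetric if $a_n=0$ for all $n$, and indeterminate if and only if $\sum_{n}(P_n^2(0)+Q_n^2(0))<\infty$. In that case the following are entire functions: $$A(z)=z\sum_{k\ge0}Q_k(0)Q_k(z),\quad B(z)=-1+z\sum_{k\ge0}Q_k(0)P_k(z),$$ $$C(z)=1+z\sum_{k\ge0}P_k(0)Q_k(z),\quad D(z)=z\sum_{k\ge0}P_k(0)P_k(z).$$ These four functions are known to have a common order $\rho\in[0,1]$ and, if $\rho>0$, a common type; these are called the order and type of the moment problem. For a non-constant entire function $f(z)=\sum c_nz^n$ with $\mathcal M_f(r)=\max_{|z|=r}|f(z)|$, the order is $\rho_f=\limsup_{r\to\infty}\frac{\log\log\mathcal M_f(r)}{\log r}$, and if $0<\rho_f<\infty$ the type is $\tau_f=\limsup_{r\to\infty}\frac{\log\mathcal M_f(r)}{r^{\rho_f}}=\frac1{e\rho_f}\limsup_{n\to\infty}\left(n|c_n|^{\rho_f/n}\right)$. The functions $G_{2c}$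 and $Z_{2c}$ have the same order $1/(2c)$ and the same type. *)

theory Defs
  imports "HOL-Analysis.Analysis"
begin

section \<open>Order and type of entire functions\<close>

definition max_modulus :: "(complex \<Rightarrow> complex) \<Rightarrow> real \<Rightarrow> real" where
  "max_modulus f r = (SUP z\<in>sphere 0 r. cmod (f z))"

text \<open>Order and type are used for non-constant entire functions only, so that
  the maximum modulus exceeds 1 for all large radii.\<close>

definition growth_order :: "(complex \<Rightarrow> complex) \<Rightarrow> ereal" where
  "growth_order f = Limsup at_top (\<lambda>r::real. ereal (ln (ln (max_modulus f r)) / ln r))"

text \<open>The type is meaningful only if the order is positive and finite.\<close>

definition growth_type :: "(complex \<Rightarrow> complex) \<Rightarrow> ereal" where
  "growth_type f = Limsup at_top
     (\<lambda>r::real. ereal (ln (max_modulus f r) / r powr real_of_ereal (growth_order f)))"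

section \<open>Hamburger moment problems given by Jacobi parameters\<close>

text \<open>Both families satisfy
  \<open>z r\<^sub>n = b\<^sub>n r\<^sub>n\<^sub>+\<^sub>1 + a\<^sub>n r\<^sub>n + b\<^sub>n\<^sub>-\<^sub>1 r\<^sub>n\<^sub>-\<^sub>1\<close> for all \<open>n \<ge> 0\<close>, where the coefficient
  of index \<open>-1\<close> is 1.  The initial values of index \<open>-1\<close> (0 for the first kind, \<open>-1\<close> for the
  second kind) are eliminated, which gives the second equation of each definition.\<close>

fun orth_poly :: "(nat \<Rightarrow> real) \<Rightarrow> (nat \<Rightarrow> real) \<Rightarrow> nat \<Rightarrow> 'a::real_normed_field \<Rightarrow> 'a" where
  "orth_poly a b 0 z = 1"
| "orth_poly a b (Suc 0) z = (z - of_real (a 0)) / of_real (b 0)"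
| "orth_poly a b (Suc (Suc n)) z =
     ((z - of_real (a (Suc n))) * orth_poly a b (Suc n) z - of_real (b n) * orth_poly a b n z)
       / of_real (b (Suc n))"

fun second_kind_poly :: "(nat \<Rightarrow> real) \<Rightarrow> (nat \<Rightarrow> real) \<Rightarrow> nat \<Rightarrow> 'a::real_normed_field \<Rightarrow> 'a" where
  "second_kind_poly a b 0 z = 0"
| "second_kind_poly a b (Suc 0) z = 1 / of_real (b 0)"
| "second_kind_poly a b (Suc (Suc n)) z =
     ((z - of_real (a (Suc n))) * second_kind_poly a b (Suc n) z
        - of_real (b n) * second_kind_poly a b n z) / of_real (b (Suc n))"

definition symmetric_problem :: "(nat \<Rightarrow> real) \<Rightarrow> bool" where
  "symmetric_problem a \<longleftrightarrow> (\<forall>n. a n = 0)"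

definition indeterminate_problem :: "(nat \<Rightarrow> real) \<Rightarrow> (nat \<Rightarrow> real) \<Rightarrow> bool" where
  "indeterminate_problem a b \<longleftrightarrow>
     summable (\<lambda>n. (orth_poly a b n (0::real))\<^sup>2 + (second_kind_poly a b n (0::real))\<^sup>2)"

definition nevanlinna_A :: "(nat \<Rightarrow> real) \<Rightarrow> (nat \<Rightarrow> real) \<Rightarrow> complex \<Rightarrow> complex" where
  "nevanlinna_A a b z = z * (\<Sum>k. second_kind_poly a b k 0 * second_kind_poly a b k z)"

definition nevanlinna_B :: "(nat \<Rightarrow> real) \<Rightarrow> (nat \<Rightarrow> real) \<Rightarrow> complex \<Rightarrow> complex" where
  "nevanlinna_B a b z = -1 + z * (\<Sum>k. second_kind_poly a b k 0 * orth_poly a b k z)"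

definition nevanlinna_C :: "(nat \<Rightarrow> real) \<Rightarrow> (nat \<Rightarrow> real) \<Rightarrow> complex \<Rightarrow> complex" where
  "nevanlinna_C a b z = 1 + z * (\<Sum>k. orth_poly a b k 0 * second_kind_poly a b k z)"

definition nevanlinna_D :: "(nat \<Rightarrow> real) \<Rightarrow> (nat \<Rightarrow> real) \<Rightarrow> complex \<Rightarrow> complex" where
  "nevanlinna_D a b z = z * (\<Sum>k. orth_poly a b k 0 * orth_poly a b k z)"

text \<open>The order and the type of an indeterminate problem are those common to the four entire
  functions above.\<close>

definition problem_has_order :: "(nat \<Rightarrow> real) \<Rightarrow> (nat \<Rightarrow> real) \<Rightarrow> ereal \<Rightarrow> bool" where
  "problem_has_order a b \<rho> \<longleftrightarrow>
     (\<forall>f \<in> {nevanlinna_A a b, nevanlinna_B a b, nevanlinna_C a b, nevanlinna_D a b}.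
        growth_order f = \<rho>)"

definition problem_has_type :: "(nat \<Rightarrow> real) \<Rightarrow> (nat \<Rightarrow> real) \<Rightarrow> ereal \<Rightarrow> bool" where
  "problem_has_type a b \<tau> \<longleftrightarrow>
     (\<forall>f \<in> {nevanlinna_A a b, nevanlinna_B a b, nevanlinna_C a b, nevanlinna_D a b}.
        growth_type f = \<tau>)"

section \<open>The comparison functions\<close>

text \<open>Tuples \<open>(k\<^sub>1, \<dots>, k\<^sub>m)\<close> are lists, so \<open>k\<^sub>i\<close> is the list entry with the 0-based
  index \<open>i - 1\<close>; this reverses the parity in the alternating inequalities.\<close>

definition gamma_indices :: "nat \<Rightarrow> nat list set" where
  "gamma_indices n = {k. length k = 2 * n \<and> (\<forall>i < 2 * n. 1 \<le> k ! i) \<and>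
     (\<forall>i. Suc i < 2 * n \<longrightarrow> (if even i then k ! i \<le> k ! Suc i else k ! i < k ! Suc i))}"

definition gamma_coeff :: "nat \<Rightarrow> real \<Rightarrow> real" where
  "gamma_coeff n p = (\<Sum>\<^sub>\<infinity>k\<in>gamma_indices n. (\<Prod>i<2 * n. real (k ! i)) powr (- p / 2))"

definition zeta_indices :: "nat \<Rightarrow> nat list set" where
  "zeta_indices n = {k. length k = n \<and> (\<forall>i < n. 1 \<le> k ! i) \<and>
     (\<forall>i. Suc i < n \<longrightarrow> k ! i < k ! Suc i)}"

definition zeta_coeff :: "nat \<Rightarrow> real \<Rightarrow> real" where
  "zeta_coeff n p = (\<Sum>\<^sub>\<infinity>k\<in>zeta_indices n.
     (\<Prod>i<n - 1. real (k ! Suc i) - real (k ! i)) * (\<Prod>i<n. real (k ! i)) powr (- p))"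

definition G_fun :: "real \<Rightarrow> complex \<Rightarrow> complex" where
  "G_fun p z = (\<Sum>n. of_real (gamma_coeff (n + 1) p) * z ^ (n + 1))"

definition Z_fun :: "real \<Rightarrow> complex \<Rightarrow> complex" where
  "Z_fun p z = (\<Sum>n. of_real (zeta_coeff (n + 2) p) * z ^ (n + 2))"

end

theory Submission
  imports Defs "HOL-Real_Asymp.Real_Asymp"
begin

text \<open>All functions involved turn out to be limits of one kind of recursion with positive coefficients,
  the ladder \<open>v' = v + y * \<alpha> k * u\<close>, \<open>u' = u + y * \<beta> k * v'\<close>, and the theorem compares
  such limits for large \<open>y\<close>.

  For the moment problem, write the solution of the recurrence at \<open>z\<close> in terms of the two solutions
  at zero.  Because the problem is symmetric, the partial sums of \<open>D\<close> and \<open>B\<close> (and of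
  \<open>C\<close> and \<open>A\<close>) then satisfy a ladder recursion with \<open>\<alpha> k = P\<^sub>2\<^sub>k(0)\<^sup>2\<close> and
  \<open>\<beta> k = Q\<^sub>2\<^sub>k\<^sub>+\<^sub>1(0)\<^sup>2\<close>.  The triangle inequality bounds their moduli by the positive ladder with
  \<open>y = \<bar>z\<bar>\<close>, and at \<open>z = \<i> * y\<close> equality holds, so the limit of the ladder is the
  maximum modulus (\<open>max_modulus_nevanlinna\<close>).  For the comparison functions, expand
  the ladder: with \<open>\<alpha> k = \<beta> k = k powr - c\<close> the limit of \<open>u\<close> is \<open>1 + G(y\<^sup>2)\<close>
  (\<open>gamma_sums\<close>), and with coefficients \<open>(y * k powr - c)\<^sup>2\<close> and \<open>1\<close> the limit of
  \<open>v\<close> is \<open>Z(y\<^sup>2)\<close> plus a term linear in \<open>y\<^sup>2\<close> (\<open>zeta_sums\<close>).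

  Order and type do not change when a function is multiplied by a power of \<open>y\<close>, and stretching
  the argument by a factor close to 1 changes the type by a factor close to 1.  This suffices for
  two comparisons.  First, finitely many rungs of a ladder contribute only a polynomial factor,
  and the rest is monotone in the coefficients, so only their asymptotics matters
  (\<open>ladder_growth\<close>).  For the moment problem \<open>\<alpha> k \<sim> A * k powr - c\<close> and
  \<open>\<beta> k \<sim> B * k powr - c\<close> with \<open>A * B = 4 powr - c\<close>, hence its functions grow like
  \<open>G\<close> at the argument \<open>(2 powr - c * y)\<^sup>2\<close>, which halves the type.  Secondly, the ladders of
  \<open>G\<close> and \<open>Z\<close> differ by a change of scale of \<open>v\<close> that varies with \<open>k\<close> like a power;
  the accumulated error telescopes to a single power of \<open>k\<close>, and rungs beyond a
  polynomial in \<open>y\<close> hardly contribute (\<open>string_comparison\<close>, \<open>model_V_le_zeta_limit\<close>).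

  The common order follows from elementary bounds for the model ladder
  (\<open>model_exp_order\<close>).  The value of the common type is never computed.\<close>

section \<open>Logarithmic growth of real functions\<close>

text \<open>The lower bound has the exact exponent and holds on a whole half-line, which is more than the
  order alone provides (a limit superior sees only a sequence of radii).  It is what makes
  polynomial factors negligible below.\<close>

definition exp_order :: "real \<Rightarrow> (real \<Rightarrow> real) \<Rightarrow> bool" where
  "exp_order \<rho> F \<longleftrightarrow>
     (\<exists>a>0. \<forall>\<^sub>F y in at_top. exp (a * y powr \<rho>) \<le> F y) \<and>
     (\<forall>s>\<rho>. \<exists>C>0. \<forall>\<^sub>F y in at_top. F y \<le> exp (C * y powr s))"

text \<open>Domination up to what neither order nor type can see: a power of the variable is killed
  by the division by \<open>y powr \<rho>\<close>, and the stretching of the argument by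
  \<open>\<mu>\<close> changes the type by a factor that tends to 1 with \<open>\<mu>\<close>.\<close>

definition growth_dominated :: "(real \<Rightarrow> real) \<Rightarrow> (real \<Rightarrow> real) \<Rightarrow> bool" where
  "growth_dominated F H \<longleftrightarrow>
     (\<forall>\<mu>>1. \<exists>C>0. \<exists>M. \<forall>\<^sub>F y in at_top. F y \<le> C * y powr M * H (\<mu> * y))"

definition exp_type :: "real \<Rightarrow> (real \<Rightarrow> real) \<Rightarrow> ereal" where
  "exp_type \<rho> F = Limsup at_top (\<lambda>y. ereal (ln (F y) / y powr \<rho>))"

lemma eventually_at_top_scale:
  fixes P :: "real \<Rightarrow> bool"
  assumes "\<forall>\<^sub>F y in at_top. P y" "k > 0"
  shows "\<forall>\<^sub>F y in at_top. P (k * y)"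
proof -
  have "filterlim (\<lambda>y::real. k * y) at_top at_top"
    using assms(2) by real_asymp
  then show ?thesis using assms(1) by (simp add: filterlim_iff)
qed

text \<open>Half of the exponent in the lower bound pays for the polynomial factor.\<close>

lemma exp_order_similar:
  assumes ord: "exp_order \<rho> H" and FH: "growth_dominated F H" and HF: "growth_dominated H F"
    and \<rho>: "\<rho> > 0"
  shows "exp_order \<rho> F"
proof -
  obtain C M where C: "C > 0" and ev: "\<forall>\<^sub>F y in at_top. F y \<le> C * y powr M * H (2 * y)"
    using FH unfolding growth_dominated_def by (meson one_less_numeral_iff semiring_norm(76))
  obtain D N where D: "D > 0" and ev': "\<forall>\<^sub>F y in at_top. H y \<le> D * y powr N * F (2 * y)"
    using HF unfolding growth_dominated_def by (meson one_less_numeral_iff semiring_norm(76))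
  obtain a where a: "a > 0" and lower: "\<forall>\<^sub>F y in at_top. exp (a * y powr \<rho>) \<le> H y"
    using ord unfolding exp_order_def by blast
  have "\<forall>\<^sub>F y in at_top. exp (a / 2 * (1/2) powr \<rho> * y powr \<rho>) \<le> F y"
  proof -
    have "\<forall>\<^sub>F y in at_top. exp (a * ((1/2) * y) powr \<rho>) \<le> H ((1/2) * y)"
      using eventually_at_top_scale[OF lower, of "1/2"] by simp
    moreover have "\<forall>\<^sub>F y in at_top. H ((1/2) * y) \<le> D * ((1/2) * y) powr N * F y"
      using eventually_at_top_scale[OF ev', of "1/2"] by (auto elim: eventually_mono)
    moreover have "\<forall>\<^sub>F y::real in at_top.
        D * ((1/2) * y) powr N \<le> exp (a / 2 * ((1/2) * y) powr \<rho>)"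
      using D a \<rho> by real_asymp
    moreover have "\<forall>\<^sub>F y::real in at_top. y > 0" by (rule eventually_gt_at_top)
    ultimately show ?thesis
    proof eventually_elim
      case (elim y)
      let ?e = "exp (a / 2 * ((1/2) * y) powr \<rho>)"
      have pos: "D * ((1/2) * y) powr N > 0" using D elim by simp
      have "?e * ?e \<le> D * ((1/2) * y) powr N * F y"
        using elim(1,2) by (simp flip: exp_add)
      then have "F y > 0"
        using pos by (smt (verit) exp_gt_zero mult_pos_pos zero_less_mult_pos)
      then have "?e * ?e \<le> ?e * F y"
        using elim(3) \<open>?e * ?e \<le> _\<close> by (smt (verit) mult_right_mono)
      then have "?e \<le> F y" by simp
      then show ?case using elim(4) by (simp only: powr_mult mult.assoc)
    qed
  qed
  moreover have "a / 2 * (1/2) powr \<rho> > 0" using a by simp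
  moreover have "\<exists>K>0. \<forall>\<^sub>F y in at_top. F y \<le> exp (K * y powr s)" if s: "s > \<rho>" for s
  proof -
    obtain K where K: "K > 0" and upper: "\<forall>\<^sub>F y in at_top. H y \<le> exp (K * y powr s)"
      using ord s unfolding exp_order_def by blast
    have s0: "s > 0" using s \<rho> by simp
    have "\<forall>\<^sub>F y::real in at_top. C * y powr M \<le> exp (1 * y powr s)"
      using C s0 by real_asymp
    with ev eventually_at_top_scale[OF upper zero_less_numeral[of "num.Bit0 num.One"]] eventually_gt_at_top[of 0]
    have "\<forall>\<^sub>F y in at_top. F y \<le> exp ((1 + K * 2 powr s) * y powr s)"
    proof eventually_elim
      case (elim y)
      have "F y \<le> C * y powr M * H (2 * y)" using elim by simp
      also have "\<dots> \<le> C * y powr M * exp (K * (2 * y) powr s)"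
        using elim C by (intro mult_left_mono) auto
      also have "\<dots> \<le> exp (1 * y powr s) * exp (K * (2 * y) powr s)"
        using elim by (intro mult_right_mono) auto
      also have "\<dots> = exp ((1 + K * 2 powr s) * y powr s)"
        using elim by (simp add: powr_mult exp_add[symmetric] algebra_simps)
      finally show ?case .
    qed
    then show ?thesis using K by (intro exI[of _ "1 + K * 2 powr s"]) (simp add: add_pos_pos)
  qed
  ultimately show ?thesis unfolding exp_order_def by blast
qed

lemma exp_order_scale:
  assumes "exp_order \<rho> F" "k > 0"
  shows "exp_order \<rho> (\<lambda>y. F (k * y))"
  unfolding exp_order_def
proof (intro conjI allI impI)
  obtain a where a: "a > 0" and lower: "\<forall>\<^sub>F y in at_top. exp (a * y powr \<rho>) \<le> F y"
    using assms(1) unfolding exp_order_def by blast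
  from eventually_at_top_scale[OF lower assms(2)] eventually_gt_at_top[of 0]
  have "\<forall>\<^sub>F y in at_top. exp ((a * k powr \<rho>) * y powr \<rho>) \<le> F (k * y)"
    by eventually_elim (use assms(2) in \<open>simp add: powr_mult mult.assoc\<close>)
  then show "\<exists>a>0. \<forall>\<^sub>F y in at_top. exp (a * y powr \<rho>) \<le> F (k * y)"
    using a assms(2) by (intro exI[of _ "a * k powr \<rho>"]) simp
next
  fix s assume "s > \<rho>"
  then obtain K where K: "K > 0" and upper: "\<forall>\<^sub>F y in at_top. F y \<le> exp (K * y powr s)"
    using assms(1) unfolding exp_order_def by blast
  from eventually_at_top_scale[OF upper assms(2)] eventually_gt_at_top[of 0]
  have "\<forall>\<^sub>F y in at_top. F (k * y) \<le> exp ((K * k powr s) * y powr s)"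
    by eventually_elim (use assms(2) in \<open>simp add: powr_mult mult.assoc\<close>)
  then show "\<exists>K>0. \<forall>\<^sub>F y in at_top. F (k * y) \<le> exp (K * y powr s)"
    using K assms(2) by (intro exI[of _ "K * k powr s"]) simp
qed

lemma exp_order_sqrt:
  assumes "exp_order \<rho> F"
  shows "exp_order (\<rho> / 2) (\<lambda>r. F (sqrt r))"
  unfolding exp_order_def
proof (intro conjI allI impI)
  have sq: "sqrt r powr s = r powr (s / 2)" if "r > 0" for r s :: real
    using that by (simp add: powr_half_sqrt[symmetric] powr_powr)
  have ev: "\<forall>\<^sub>F r in at_top. P (sqrt r)" if "\<forall>\<^sub>F y in at_top. P y" for P :: "real \<Rightarrow> bool"
    using that sqrt_at_top by (simp add: filterlim_iff)
  obtain a where a: "a > 0" and lower: "\<forall>\<^sub>F y in at_top. exp (a * y powr \<rho>) \<le> F y"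
    using assms(1) unfolding exp_order_def by blast
  from ev[OF lower] eventually_gt_at_top[of 0]
  have "\<forall>\<^sub>F r in at_top. exp (a * r powr (\<rho> / 2)) \<le> F (sqrt r)"
    by eventually_elim (simp add: sq)
  then show "\<exists>a>0. \<forall>\<^sub>F r in at_top. exp (a * r powr (\<rho> / 2)) \<le> F (sqrt r)"
    using a by blast
  fix s assume "s > \<rho> / 2"
  then have "2 * s > \<rho>" by simp
  then obtain K where K: "K > 0" and upper: "\<forall>\<^sub>F y in at_top. F y \<le> exp (K * y powr (2 * s))"
    using assms(1) unfolding exp_order_def by blast
  from ev[OF upper] eventually_gt_at_top[of 0]
  have "\<forall>\<^sub>F r in at_top. F (sqrt r) \<le> exp (K * r powr s)"
    by eventually_elim (simp add: sq)
  then show "\<exists>K>0. \<forall>\<^sub>F r in at_top. F (sqrt r) \<le> exp (K * r powr s)"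
    using K by blast
qed

lemma exp_order_tendsto:
  assumes ord: "exp_order \<rho> F" and \<rho>: "\<rho> > 0"
  shows "((\<lambda>r. ln (ln (F r)) / ln r) \<longlongrightarrow> \<rho>) at_top"
proof (rule order_tendstoI)
  obtain a where a: "a > 0" and lower: "\<forall>\<^sub>F y in at_top. exp (a * y powr \<rho>) \<le> F y"
    using ord unfolding exp_order_def by blast
  fix x assume x: "x < \<rho>"
  have "\<forall>\<^sub>F r::real in at_top. r powr x < a * r powr \<rho>"
    using a \<rho> x by real_asymp
  with lower eventually_gt_at_top[of 1]
  show "\<forall>\<^sub>F r in at_top. x < ln (ln (F r)) / ln r"
  proof eventually_elim
    case (elim r)
    have F: "F r > 0" using elim(1) by (meson exp_gt_zero less_le_trans)
    have "a * r powr \<rho> \<le> ln (F r)" using elim(1) F by (simp add: ln_ge_iff)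
    then have "r powr x < ln (F r)" using elim by linarith
    then have "ln (r powr x) < ln (ln (F r))"
      using elim by (subst ln_less_cancel_iff) (auto intro: less_trans[rotated])
    then have "x * ln r < ln (ln (F r))" using elim by (simp add: ln_powr)
    then show ?case using elim by (simp add: pos_less_divide_eq)
  qed
next
  obtain a where a: "a > 0" and lower: "\<forall>\<^sub>F y in at_top. exp (a * y powr \<rho>) \<le> F y"
    using ord unfolding exp_order_def by blast
  fix x assume x: "x > \<rho>"
  then have "(\<rho> + x) / 2 > \<rho>" by simp
  then obtain K where K: "K > 0"
      and upper: "\<forall>\<^sub>F y in at_top. F y \<le> exp (K * y powr ((\<rho> + x) / 2))"
    using ord unfolding exp_order_def by blast
  have "\<forall>\<^sub>F r::real in at_top. K * r powr ((\<rho> + x) / 2) < r powr x"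
    using K \<rho> x by real_asymp
  with lower upper eventually_gt_at_top[of 1]
  show "\<forall>\<^sub>F r in at_top. ln (ln (F r)) / ln r < x"
  proof eventually_elim
    case (elim r)
    have F: "F r > 0" using elim(1) by (meson exp_gt_zero less_le_trans)
    have "a * r powr \<rho> \<le> ln (F r)" using elim(1) F by (simp add: ln_ge_iff)
    moreover have "a * r powr \<rho> > 0" using a elim by simp
    ultimately have lnF: "ln (F r) > 0" by linarith
    have "ln (F r) \<le> ln (exp (K * r powr ((\<rho> + x) / 2)))"
      using elim F by (subst ln_le_cancel_iff) auto
    then have "ln (F r) < r powr x" using elim by simp
    then have "ln (ln (F r)) < ln (r powr x)"
      using lnF by (subst ln_less_cancel_iff) (auto intro: less_trans)
    then have "ln (ln (F r)) < x * ln r" using elim by (simp add: ln_powr)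
    then show ?case using elim by (simp add: pos_divide_less_eq)
  qed
qed

lemma growth_order_type_eq:
  assumes eq: "\<And>r. r > 0 \<Longrightarrow> max_modulus f r = F r"
    and ord: "exp_order \<rho> F" and \<rho>: "\<rho> > 0"
  shows "growth_order f = ereal \<rho>" "growth_type f = exp_type \<rho> F"
proof -
  have ev: "\<forall>\<^sub>F r in at_top. max_modulus f r = F r"
    using eventually_gt_at_top[of 0] by eventually_elim (rule eq)
  have "growth_order f = Limsup at_top (\<lambda>r. ereal (ln (ln (F r)) / ln r))"
    unfolding growth_order_def by (rule Limsup_eq) (use ev in \<open>auto elim: eventually_mono\<close>)
  also have "\<dots> = ereal \<rho>"
    by (rule lim_imp_Limsup) (use exp_order_tendsto[OF ord \<rho>] in simp_all)
  finally show *: "growth_order f = ereal \<rho>" .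
  show "growth_type f = exp_type \<rho> F"
    unfolding growth_type_def exp_type_def *
    by (rule Limsup_eq) (use ev in \<open>auto elim: eventually_mono\<close>)
qed

text \<open>This is the source of the factor 1/2 in the type of the moment problem, and of the factor close
  to 1 in comparisons.\<close>

lemma exp_type_scale:
  assumes "k > 0"
  shows "exp_type \<rho> (\<lambda>y. F (k * y)) = ereal (k powr \<rho>) * exp_type \<rho> F"
proof -
  have inj: "inj (\<lambda>y::real. k * y)" using assms by (intro injI) simp
  have "exp_type \<rho> (\<lambda>y. F (k * y)) =
      Limsup at_top (\<lambda>y. ereal (k powr \<rho>) * ereal (ln (F (k * y)) / (k * y) powr \<rho>))"
    unfolding exp_type_def
  proof (rule Limsup_eq)
    show "\<forall>\<^sub>F y in at_top. ereal (ln (F (k * y)) / y powr \<rho>) =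
        ereal (k powr \<rho>) * ereal (ln (F (k * y)) / (k * y) powr \<rho>)"
      using eventually_gt_at_top[of 0]
      by eventually_elim (use assms in \<open>simp add: powr_mult\<close>)
  qed
  also have "\<dots> = ereal (k powr \<rho>) * Limsup at_top (\<lambda>y. ereal (ln (F (k * y)) / (k * y) powr \<rho>))"
    by (rule Limsup_ereal_mult_left) auto
  also have "Limsup at_top (\<lambda>y. ereal (ln (F (k * y)) / (k * y) powr \<rho>)) =
      Limsup (filtermap (\<lambda>y. k * y) at_top) (\<lambda>t. ereal (ln (F t) / t powr \<rho>))"
    by (rule Limsup_filtermap_eq[OF inj, symmetric])
  also have "filtermap (\<lambda>y. k * y) at_top = at_top"
  proof (rule filtermap_fun_inverse)
    show "filterlim (\<lambda>y::real. y / k) at_top at_top" "filterlim (\<lambda>y::real. k * y) at_top at_top"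
      using assms by real_asymp+
  qed (use assms in simp)
  finally show ?thesis unfolding exp_type_def .
qed

text \<open>This relates a series in \<open>r = y\<^sup>2\<close> to the same series as a function of \<open>y\<close>: the order is
  halved and the type stays.\<close>

lemma exp_type_sqrt: "exp_type (\<rho> / 2) (\<lambda>r. F (sqrt r)) = exp_type \<rho> F"
proof -
  have inj: "inj sqrt" by (intro injI) simp
  have "exp_type (\<rho> / 2) (\<lambda>r. F (sqrt r)) =
      Limsup at_top (\<lambda>r. ereal (ln (F (sqrt r)) / sqrt r powr \<rho>))"
    unfolding exp_type_def
  proof (rule Limsup_eq)
    show "\<forall>\<^sub>F r in at_top. ereal (ln (F (sqrt r)) / r powr (\<rho> / 2)) =
        ereal (ln (F (sqrt r)) / sqrt r powr \<rho>)"
      using eventually_gt_at_top[of 0]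
      by eventually_elim (simp add: powr_half_sqrt[symmetric] powr_powr)
  qed
  also have "\<dots> = Limsup (filtermap sqrt at_top) (\<lambda>t. ereal (ln (F t) / t powr \<rho>))"
    by (rule Limsup_filtermap_eq[OF inj, symmetric])
  also have "filtermap sqrt at_top = at_top"
  proof (rule filtermap_fun_inverse[OF _ sqrt_at_top])
    show "filterlim (\<lambda>x::real. x\<^sup>2) at_top at_top" by real_asymp
    show "\<forall>\<^sub>F x in at_top. sqrt (x\<^sup>2) = x"
      using eventually_ge_at_top[of 0] by eventually_elim simp
  qed
  finally show ?thesis unfolding exp_type_def .
qed

lemma Limsup_le_perturb:
  fixes f g h :: "real \<Rightarrow> real"
  assumes le: "\<forall>\<^sub>F y in at_top. f y \<le> g y + h y" and h: "(h \<longlongrightarrow> 0) at_top"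
  shows "Limsup at_top (\<lambda>y. ereal (f y)) \<le> Limsup at_top (\<lambda>y. ereal (g y))"
proof (rule ereal_le_real)
  fix z assume z: "Limsup at_top (\<lambda>y. ereal (g y)) \<le> ereal z"
  show "Limsup at_top (\<lambda>y. ereal (f y)) \<le> ereal z"
  proof (rule ereal_le_epsilon2)
    fix e :: real assume e: "e > 0"
    have "Limsup at_top (\<lambda>y. ereal (g y)) < ereal (z + e / 2)"
      by (rule le_less_trans[OF z]) (use e in simp)
    then have "\<forall>\<^sub>F y in at_top. g y < z + e / 2"
      by (auto dest!: Limsup_lessD)
    moreover have "\<forall>\<^sub>F y in at_top. h y < e / 2"
      using order_tendstoD(2)[OF h, of "e / 2"] e by simp
    ultimately have "\<forall>\<^sub>F y in at_top. ereal (f y) \<le> ereal z + ereal e"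
      using le by eventually_elim simp
    then show "Limsup at_top (\<lambda>y. ereal (f y)) \<le> ereal z + ereal e"
      by (rule Limsup_bounded)
  qed
qed

text \<open>For fixed \<open>\<mu> > 1\<close> domination gives the factor \<open>\<mu> powr \<rho>\<close>; then let
  \<open>\<mu>\<close> tend to 1.  The lower bound in the order makes the type of \<open>H\<close> nonnegative, so it is
  a real number, where this limit passage works, or \<open>\<infinity>\<close>, where there is nothing to prove.\<close>

lemma exp_type_similar_le:
  assumes ord: "exp_order \<rho> F" "exp_order \<rho> H" and FH: "growth_dominated F H"
    and \<rho>: "\<rho> > 0"
  shows "exp_type \<rho> F \<le> exp_type \<rho> H"
proof -
  have le: "exp_type \<rho> F \<le> ereal (\<mu> powr \<rho>) * exp_type \<rho> H" if \<mu>: "\<mu> > 1" for \<mu>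
  proof -
    obtain C M where C: "C > 0" and ev: "\<forall>\<^sub>F y in at_top. F y \<le> C * y powr M * H (\<mu> * y)"
      using FH \<mu> unfolding growth_dominated_def by blast
    have ev_pos: "\<forall>\<^sub>F y in at_top. f y > 0" if f: "exp_order \<rho> f" for f
    proof -
      obtain a where "\<forall>\<^sub>F y in at_top. exp (a * y powr \<rho>) \<le> f y"
        using f unfolding exp_order_def by blast
      then show ?thesis by (rule eventually_mono) (rule less_le_trans[OF exp_gt_zero])
    qed
    note pos = ev_pos[OF ord(1)] ev_pos[OF ord(2)]
    have pos': "\<forall>\<^sub>F y in at_top. H (\<mu> * y) > 0"
      using eventually_at_top_scale[OF pos(2)] \<mu> by simp
    have "\<forall>\<^sub>F y in at_top. ln (F y) / y powr \<rho>
        \<le> ln (H (\<mu> * y)) / y powr \<rho> + (ln C + M * ln y) / y powr \<rho>"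
      using ev pos(1) pos' eventually_gt_at_top[of 0]
    proof eventually_elim
      case (elim y)
      have "ln (F y) \<le> ln (C * y powr M * H (\<mu> * y))"
        using elim C by (subst ln_le_cancel_iff) auto
      also have "\<dots> = ln (H (\<mu> * y)) + (ln C + M * ln y)"
        using elim C by (simp add: ln_mult ln_powr)
      finally show ?case using elim by (simp add: add_divide_distrib[symmetric] divide_right_mono)
    qed
    moreover have "((\<lambda>y. (ln C + M * ln y) / y powr \<rho>) \<longlongrightarrow> 0) at_top"
      using \<rho> by real_asymp
    ultimately have "exp_type \<rho> F \<le> exp_type \<rho> (\<lambda>y. H (\<mu> * y))"
      unfolding exp_type_def by (rule Limsup_le_perturb)
    then show ?thesis using exp_type_scale[of \<mu> \<rho> H] \<mu> by simp
  qed
  have nonneg: "0 \<le> exp_type \<rho> H"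
  proof -
    obtain a where a: "a > 0" and lower: "\<forall>\<^sub>F y in at_top. exp (a * y powr \<rho>) \<le> H y"
      using ord unfolding exp_order_def by blast
    from lower eventually_gt_at_top[of 0]
    have "\<forall>\<^sub>F y in at_top. 0 \<le> ereal (ln (H y) / y powr \<rho>)"
    proof eventually_elim
      case (elim y)
      have "1 \<le> H y"
        using elim a by (smt (verit) mult_nonneg_nonneg one_le_exp_iff powr_ge_zero)
      then show ?case by simp
    qed
    then have "Liminf at_top (\<lambda>y. ereal (ln (H y) / y powr \<rho>)) \<ge> 0"
      by (rule Liminf_bounded)
    also have "\<dots> \<le> exp_type \<rho> H"
      unfolding exp_type_def by (rule Liminf_le_Limsup) simp
    finally show ?thesis .
  qed
  show ?thesis
  proof (cases "exp_type \<rho> H")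
    case (real t)
    have "((\<lambda>\<mu>. ereal (\<mu> powr \<rho> * t)) \<longlongrightarrow> ereal (1 powr \<rho> * t)) (at_right 1)"
      by (intro tendsto_intros) auto
    moreover have "\<forall>\<^sub>F \<mu> in at_right 1. exp_type \<rho> F \<le> ereal (\<mu> powr \<rho> * t)"
      using eventually_at_right_less[of 1]
      by eventually_elim (use le real in auto)
    ultimately have "exp_type \<rho> F \<le> ereal (1 powr \<rho> * t)"
      by (intro tendsto_lowerbound) auto
    then show ?thesis using real by simp
  qed (use nonneg in auto)
qed

lemma exp_type_similar:
  assumes "exp_order \<rho> H" "growth_dominated F H" "growth_dominated H F" "\<rho> > 0"
  shows "exp_type \<rho> F = exp_type \<rho> H"
  using exp_type_similar_le assms exp_order_similar[OF assms] by (metis antisym)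

lemma growth_dominated_refl:
  assumes mono: "\<And>x y. 0 < x \<Longrightarrow> x \<le> y \<Longrightarrow> H x \<le> H y"
  shows "growth_dominated H H"
  unfolding growth_dominated_def
proof (intro allI impI)
  fix \<mu> :: real assume \<mu>: "\<mu> > 1"
  from eventually_gt_at_top[of 0] have "\<forall>\<^sub>F y in at_top. H y \<le> 1 * y powr 0 * H (\<mu> * y)"
    by eventually_elim (use \<mu> in \<open>auto intro!: mono\<close>)
  then show "\<exists>C>0. \<exists>M. \<forall>\<^sub>F y in at_top. H y \<le> C * y powr M * H (\<mu> * y)"
    by (meson zero_less_one)
qed

lemma growth_dominated_poly_left:
  assumes "C > 0" "\<forall>\<^sub>F y in at_top. F y \<le> C * y powr M * G y" "growth_dominated G H"
  shows "growth_dominated F H"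
  unfolding growth_dominated_def
proof (intro allI impI)
  fix \<mu> :: real assume \<mu>: "\<mu> > 1"
  obtain D N where D: "D > 0" "\<forall>\<^sub>F y in at_top. G y \<le> D * y powr N * H (\<mu> * y)"
    using assms(3) \<mu> unfolding growth_dominated_def by blast
  from assms(2) D(2) have "\<forall>\<^sub>F y in at_top. F y \<le> (C * D) * y powr (M + N) * H (\<mu> * y)"
  proof eventually_elim
    case (elim y)
    have "F y \<le> C * y powr M * G y" by fact
    also have "\<dots> \<le> C * y powr M * (D * y powr N * H (\<mu> * y))"
      using elim assms(1) by (intro mult_left_mono) auto
    finally show ?case by (simp add: powr_add mult_ac)
  qed
  then show "\<exists>C>0. \<exists>M. \<forall>\<^sub>F y in at_top. F y \<le> C * y powr M * H (\<mu> * y)"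
    using D(1) assms(1) by (meson mult_pos_pos)
qed

lemma growth_dominated_poly_right:
  assumes "C > 0" "\<forall>\<^sub>F y in at_top. G y \<le> C * y powr M * H y" "growth_dominated F G"
  shows "growth_dominated F H"
  unfolding growth_dominated_def
proof (intro allI impI)
  fix \<mu> :: real assume \<mu>: "\<mu> > 1"
  obtain D N where D: "D > 0" "\<forall>\<^sub>F y in at_top. F y \<le> D * y powr N * G (\<mu> * y)"
    using assms(3) \<mu> unfolding growth_dominated_def by blast
  have "\<forall>\<^sub>F y in at_top. G (\<mu> * y) \<le> C * (\<mu> * y) powr M * H (\<mu> * y)"
    using eventually_at_top_scale[OF assms(2)] \<mu> by simp
  with D(2) eventually_gt_at_top[of 0]
  have "\<forall>\<^sub>F y in at_top. F y \<le> (D * C * \<mu> powr M) * y powr (N + M) * H (\<mu> * y)"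
  proof eventually_elim
    case (elim y)
    have "F y \<le> D * y powr N * G (\<mu> * y)" by fact
    also have "\<dots> \<le> D * y powr N * (C * (\<mu> * y) powr M * H (\<mu> * y))"
      using elim D(1) by (intro mult_left_mono) auto
    finally show ?case using elim \<mu> by (simp add: powr_add powr_mult mult_ac)
  qed
  moreover have "D * C * \<mu> powr M > 0" using D(1) assms(1) \<mu> by simp
  ultimately show "\<exists>C>0. \<exists>M. \<forall>\<^sub>F y in at_top. F y \<le> C * y powr M * H (\<mu> * y)"
    by blast
qed

section \<open>Ladder recursions\<close>

text \<open>The recursion of an electrical ladder network, equivalently of a Stieltjes string.  Expanding
  it from the start \<open>(1, 0)\<close> gives, in the first component, the sum of the products
  \<open>\<alpha> k\<^sub>1 * \<beta> k\<^sub>2 * \<alpha> k\<^sub>3 * \<beta> k\<^sub>4 * \<dots>\<close> of even length over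
  \<open>k\<^sub>1 \<le> k\<^sub>2 < k\<^sub>3 \<le> k\<^sub>4 < \<dots>\<close>, because the new \<open>v\<close> enters the update of
  \<open>u\<close> at the same index.  The second component collects the products of odd length.\<close>

primrec ladder :: "(nat \<Rightarrow> real) \<Rightarrow> (nat \<Rightarrow> real) \<Rightarrow> real \<times> real \<Rightarrow> nat \<Rightarrow> real \<times> real" where
  "ladder \<alpha> \<beta> s 0 = s"
| "ladder \<alpha> \<beta> s (Suc k) =
     (let v = snd (ladder \<alpha> \<beta> s k) + \<alpha> k * fst (ladder \<alpha> \<beta> s k)
      in (fst (ladder \<alpha> \<beta> s k) + \<beta> k * v, v))"

lemma snd_ladder_Suc:
    "snd (ladder \<alpha> \<beta> s (Suc k)) = snd (ladder \<alpha> \<beta> s k) + \<alpha> k * fst (ladder \<alpha> \<beta> s k)"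
  and fst_ladder_Suc:
    "fst (ladder \<alpha> \<beta> s (Suc k)) = fst (ladder \<alpha> \<beta> s k) + \<beta> k * snd (ladder \<alpha> \<beta> s (Suc k))"
  by (simp_all add: Let_def)

declare ladder.simps(2) [simp del]

lemmas ladder_Suc = snd_ladder_Suc fst_ladder_Suc

lemma ladder_mono:
  assumes "\<And>k. 0 \<le> \<alpha> k" "\<And>k. 0 \<le> \<beta> k" "\<And>k. \<alpha> k \<le> \<alpha>' k" "\<And>k. \<beta> k \<le> \<beta>' k"
    and "0 \<le> fst s" "0 \<le> snd s" "fst s \<le> fst s'" "snd s \<le> snd s'"
  shows "0 \<le> fst (ladder \<alpha> \<beta> s k) \<and> 0 \<le> snd (ladder \<alpha> \<beta> s k) \<and>
    fst (ladder \<alpha> \<beta> s k) \<le> fst (ladder \<alpha>' \<beta>' s' k) \<and>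
    snd (ladder \<alpha> \<beta> s k) \<le> snd (ladder \<alpha>' \<beta>' s' k)"
proof (induction k)
  case (Suc k)
  let ?u = "fst (ladder \<alpha> \<beta> s k)" and ?v = "snd (ladder \<alpha> \<beta> s k)"
  let ?u' = "fst (ladder \<alpha>' \<beta>' s' k)" and ?v' = "snd (ladder \<alpha>' \<beta>' s' k)"
  have "\<alpha> k * ?u \<le> \<alpha>' k * ?u'" "0 \<le> \<alpha> k * ?u"
    using Suc assms(1,3)[of k] by (auto intro!: mult_mono)
  then have v: "snd (ladder \<alpha> \<beta> s (Suc k)) \<le> snd (ladder \<alpha>' \<beta>' s' (Suc k))"
    "0 \<le> snd (ladder \<alpha> \<beta> s (Suc k))"
    using Suc by (auto simp: snd_ladder_Suc)
  then have "\<beta> k * snd (ladder \<alpha> \<beta> s (Suc k)) \<le> \<beta>' k * snd (ladder \<alpha>' \<beta>' s' (Suc k))"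
    "0 \<le> \<beta> k * snd (ladder \<alpha> \<beta> s (Suc k))"
    using assms(2,4)[of k] by (auto intro!: mult_mono)
  then show ?case using v Suc by (simp add: fst_ladder_Suc)
qed (use assms in simp)

text \<open>Changing the unit of \<open>v\<close> moves a constant factor from \<open>\<beta>\<close> to \<open>\<alpha>\<close>.  Only the
  product of the two coefficient sequences therefore matters for the growth.\<close>

lemma ladder_scale:
  assumes "m \<noteq> 0"
  shows "ladder (\<lambda>k. m * \<alpha> k) (\<lambda>k. \<beta> k / m) (u, m * v) k =
    (fst (ladder \<alpha> \<beta> (u, v) k), m * snd (ladder \<alpha> \<beta> (u, v) k))"
  using assms by (induction k) (simp_all add: prod_eq_iff ladder_Suc algebra_simps)

lemma ladder_homogeneous:
  "ladder \<alpha> \<beta> (c * fst s, c * snd s) k = (c * fst (ladder \<alpha> \<beta> s k), c * snd (ladder \<alpha> \<beta> s k))"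
  by (induction k) (simp_all add: prod_eq_iff ladder_Suc algebra_simps)

lemma ladder_shift:
  "ladder \<alpha> \<beta> s (n + k) = ladder (\<lambda>k. \<alpha> (n + k)) (\<lambda>k. \<beta> (n + k)) (ladder \<alpha> \<beta> s n) k"
  by (induction k) (simp_all add: prod_eq_iff ladder_Suc)

lemma ladder_sum_le:
  assumes "\<And>k. 0 \<le> \<alpha> k" "\<And>k. 0 \<le> \<beta> k" "0 \<le> fst s" "0 \<le> snd s"
  shows "fst (ladder \<alpha> \<beta> s k) + snd (ladder \<alpha> \<beta> s k)
    \<le> (fst s + snd s) * (\<Prod>j<k. (1 + \<alpha> j) * (1 + \<beta> j))"
proof (induction k)
  case (Suc k)
  let ?u = "fst (ladder \<alpha> \<beta> s k)" and ?v = "snd (ladder \<alpha> \<beta> s k)"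
  have nn: "0 \<le> ?u" "0 \<le> ?v" using ladder_mono[of \<alpha> \<beta> \<alpha> \<beta> s s k] assms by auto
  have "fst (ladder \<alpha> \<beta> s (Suc k)) + snd (ladder \<alpha> \<beta> s (Suc k))
      = ?u + (1 + \<beta> k) * (?v + \<alpha> k * ?u)"
    by (simp add: ladder_Suc algebra_simps)
  also have "\<dots> \<le> (?u + ?v) * ((1 + \<alpha> k) * (1 + \<beta> k))"
    using nn assms(1,2)[of k] by (simp add: algebra_simps)
  also have "\<dots> \<le> (fst s + snd s) * (\<Prod>j<k. (1 + \<alpha> j) * (1 + \<beta> j)) * ((1 + \<alpha> k) * (1 + \<beta> k))"
    using Suc assms(1,2)[of k] by (intro mult_right_mono) auto
  finally show ?case by (simp add: mult_ac)
qed simp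

locale nonneg_ladder =
  fixes \<alpha> \<beta> :: "nat \<Rightarrow> real" and s :: "real \<times> real"
  assumes coeffs_nonneg: "\<And>k. 0 \<le> \<alpha> k" "\<And>k. 0 \<le> \<beta> k"
    and start_nonneg: "0 \<le> fst s" "0 \<le> snd s"
begin

abbreviation "u k \<equiv> fst (ladder \<alpha> \<beta> s k)"
abbreviation "v k \<equiv> snd (ladder \<alpha> \<beta> s k)"

lemma nonneg: "0 \<le> u k" "0 \<le> v k"
  using ladder_mono[of \<alpha> \<beta> \<alpha> \<beta> s s k] coeffs_nonneg start_nonneg by auto

lemma incseq: "incseq u" "incseq v"
  using nonneg coeffs_nonneg by (auto intro!: incseq_SucI simp: ladder_Suc nonneg[unfolded snd_ladder_Suc])

end

definition ladder_limits :: "(nat \<Rightarrow> real) \<Rightarrow> (nat \<Rightarrow> real) \<Rightarrow> real \<times> real \<Rightarrow> real \<times> real" where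
  "ladder_limits \<alpha> \<beta> s =
     (lim (\<lambda>k. fst (ladder \<alpha> \<beta> s k)), lim (\<lambda>k. snd (ladder \<alpha> \<beta> s k)))"

locale summable_ladder = nonneg_ladder +
  assumes summable: "summable \<alpha>" "summable \<beta>"
begin

abbreviation "U \<equiv> fst (ladder_limits \<alpha> \<beta> s)"
abbreviation "V \<equiv> snd (ladder_limits \<alpha> \<beta> s)"

lemma bounded: "u k + v k \<le> (fst s + snd s) * exp (suminf \<alpha> + suminf \<beta>)"
proof -
  have "u k + v k \<le> (fst s + snd s) * (\<Prod>j<k. (1 + \<alpha> j) * (1 + \<beta> j))"
    by (intro ladder_sum_le coeffs_nonneg start_nonneg)
  also have "(\<Prod>j<k. (1 + \<alpha> j) * (1 + \<beta> j)) \<le> (\<Prod>j<k. exp (\<alpha> j + \<beta> j))"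
    using coeffs_nonneg by (intro prod_mono) (auto simp: exp_add intro!: mult_mono)
  also have "\<dots> = exp ((\<Sum>j<k. \<alpha> j) + (\<Sum>j<k. \<beta> j))"
    by (simp add: exp_sum sum.distrib flip: exp_sum)
  also have "\<dots> \<le> exp (suminf \<alpha> + suminf \<beta>)"
    using summable coeffs_nonneg by (auto intro!: add_mono sum_le_suminf)
  finally show ?thesis using start_nonneg by (simp add: mult_left_mono)
qed

lemma tendsto: "u \<longlonglongrightarrow> U" "v \<longlonglongrightarrow> V"
proof -
  let ?B = "(fst s + snd s) * exp (suminf \<alpha> + suminf \<beta>)"
  have "u k \<le> ?B" "v k \<le> ?B" for k
    using bounded[of k] nonneg[of k] by linarith+
  then have "convergent u" "convergent v"
    using incseq_convergent[OF incseq(1), of ?B] incseq_convergent[OF incseq(2), of ?B]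
    by (metis convergentI)+
  then show "u \<longlonglongrightarrow> U" "v \<longlonglongrightarrow> V"
    unfolding ladder_limits_def by (simp_all add: convergent_LIMSEQ_iff)
qed

lemma le_limits: "u k \<le> U" "v k \<le> V"
  using incseq_le[OF incseq(1) tendsto(1)] incseq_le[OF incseq(2) tendsto(2)] by auto

lemma limits_nonneg: "0 \<le> U" "0 \<le> V"
  using nonneg[of 0] le_limits[of 0] by linarith+

text \<open>Every increment of one component is a coefficient times the other component, which stays
  below its limit.\<close>

lemma diff_le:
  assumes "n \<le> k"
  shows "u k - u n \<le> V * (\<Sum>j=n..<k. \<beta> j)" "v k - v n \<le> U * (\<Sum>j=n..<k. \<alpha> j)"
proof -
  have "u (Suc j) - u j \<le> V * \<beta> j" "v (Suc j) - v j \<le> U * \<alpha> j" for j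
    using mult_right_mono[OF le_limits(2)[of "Suc j"] coeffs_nonneg(2)[of j]]
      mult_right_mono[OF le_limits(1)[of j] coeffs_nonneg(1)[of j]]
    by (simp_all add: ladder_Suc mult_ac)
  then have "(\<Sum>j=n..<k. u (Suc j) - u j) \<le> (\<Sum>j=n..<k. V * \<beta> j)"
    "(\<Sum>j=n..<k. v (Suc j) - v j) \<le> (\<Sum>j=n..<k. U * \<alpha> j)"
    by (auto intro: sum_mono)
  then show "u k - u n \<le> V * (\<Sum>j=n..<k. \<beta> j)" "v k - v n \<le> U * (\<Sum>j=n..<k. \<alpha> j)"
    using sum_Suc_diff'[OF assms, of u] sum_Suc_diff'[OF assms, of v] by (simp_all add: sum_distrib_left)
qed

lemma limit_diff_le:
  shows "U - u n \<le> V * (\<Sum>j. \<beta> (j + n))" "V - v n \<le> U * (\<Sum>j. \<alpha> (j + n))"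
proof -
  have tail: "(\<Sum>j=n..<k. f j) \<le> (\<Sum>j. f (j + n))"
    if "summable f" "\<And>j. 0 \<le> f j" for f :: "nat \<Rightarrow> real" and k
  proof -
    have "(\<Sum>j=n..<k. f j) = (\<Sum>j<k - n. f (j + n))"
      by (cases "n \<le> k") (auto simp: sum.atLeastLessThan_shift_0[of _ n] atLeast0LessThan add.commute)
    also have "\<dots> \<le> (\<Sum>j. f (j + n))"
      using that by (intro sum_le_suminf) (auto simp: summable_iff_shift)
    finally show ?thesis .
  qed
  have "u k \<le> u n + V * (\<Sum>j. \<beta> (j + n))" "v k \<le> v n + U * (\<Sum>j. \<alpha> (j + n))" if "n \<le> k" for k
    using diff_le[OF that] mult_left_mono[OF tail[of \<beta> k] limits_nonneg(2)]
      mult_left_mono[OF tail[of \<alpha> k] limits_nonneg(1)] summable coeffs_nonneg by fastforce+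
  then have "U \<le> u n + V * (\<Sum>j. \<beta> (j + n))" "V \<le> v n + U * (\<Sum>j. \<alpha> (j + n))"
    by (auto intro!: LIMSEQ_le_const2[OF tendsto(1)] LIMSEQ_le_const2[OF tendsto(2)])
  then show "U - u n \<le> V * (\<Sum>j. \<beta> (j + n))" "V - v n \<le> U * (\<Sum>j. \<alpha> (j + n))"
    by linarith+
qed

end

lemma ladder_limits_mono:
  assumes "summable_ladder \<alpha> \<beta> s" "summable_ladder \<alpha>' \<beta>' s'"
    and "\<And>k. \<alpha> k \<le> \<alpha>' k" "\<And>k. \<beta> k \<le> \<beta>' k" "fst s \<le> fst s'" "snd s \<le> snd s'"
  shows "fst (ladder_limits \<alpha> \<beta> s) \<le> fst (ladder_limits \<alpha>' \<beta>' s')"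
    "snd (ladder_limits \<alpha> \<beta> s) \<le> snd (ladder_limits \<alpha>' \<beta>' s')"
proof -
  interpret L: summable_ladder \<alpha> \<beta> s by fact
  interpret L': summable_ladder \<alpha>' \<beta>' s' by fact
  have "L.u k \<le> L'.u k" "L.v k \<le> L'.v k" for k
    using ladder_mono[of \<alpha> \<beta> \<alpha>' \<beta>' s s' k] assms(3-) L.coeffs_nonneg L.start_nonneg by auto
  then show "L.U \<le> L'.U" "L.V \<le> L'.V"
    by (auto intro: LIMSEQ_le[OF L.tendsto(1) L'.tendsto(1)] LIMSEQ_le[OF L.tendsto(2) L'.tendsto(2)])
qed

section \<open>Growth of a ladder is determined by the asymptotics of its coefficients\<close>

abbreviation ladder_at where
  "ladder_at \<alpha> \<beta> s y \<equiv> ladder (\<lambda>k. y * \<alpha> k) (\<lambda>k. y * \<beta> k) s"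

abbreviation ladder_limits_at where
  "ladder_limits_at \<alpha> \<beta> s y \<equiv> ladder_limits (\<lambda>k. y * \<alpha> k) (\<lambda>k. y * \<beta> k) s"

lemma ladder_pos:
  assumes pos: "\<And>k. 0 < \<alpha> k" "\<And>k. 0 < \<beta> k"
    and s: "0 \<le> fst s" "0 \<le> snd s" "0 < fst s + snd s" and k: "k \<ge> 1"
  shows "0 < fst (ladder \<alpha> \<beta> s k)" "0 < snd (ladder \<alpha> \<beta> s k)"
proof -
  interpret nonneg_ladder \<alpha> \<beta> s
    using assms by unfold_locales (auto intro: less_imp_le)
  have v: "v (Suc 0) > 0"
    using s pos(1)[of 0] by (cases "fst s = 0") (auto simp: ladder_Suc intro!: add_nonneg_pos)
  then have u: "u (Suc 0) > 0"
    using s pos(2)[of 0] by (auto simp: fst_ladder_Suc intro!: add_nonneg_pos)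
  show "0 < u k" "0 < v k"
    using incseqD[OF incseq(1), of "Suc 0" k] incseqD[OF incseq(2), of "Suc 0" k] u v k by auto
qed

text \<open>The first \<open>n\<close> rungs, where nothing is known about the coefficients, multiply the state by a
  polynomial in \<open>y\<close> of degree \<open>2 * n\<close> at most, while the primed state is bounded below by a
  positive constant for all \<open>y \<ge> 1\<close>.  So at rung \<open>n\<close> the states compare up to a polynomial
  factor, and linearity and monotonicity carry this comparison through the remaining rungs.\<close>

lemma ladder_dominated:
  assumes nonneg: "\<And>k. 0 \<le> \<alpha> k" "\<And>k. 0 \<le> \<beta> k" "0 \<le> fst s" "0 \<le> snd s"
    and pos: "\<And>k. 0 < \<alpha>' k" "\<And>k. 0 < \<beta>' k" "0 \<le> fst s'" "0 \<le> snd s'" "0 < fst s' + snd s'"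
    and \<mu>: "\<mu> \<ge> 1" and ev: "\<forall>\<^sub>F k in sequentially. \<alpha> k \<le> \<mu> * \<alpha>' k \<and> \<beta> k \<le> \<mu> * \<beta>' k"
  shows "\<exists>C>0. \<exists>M. \<forall>y\<ge>1. \<forall>\<^sub>F k in sequentially.
    fst (ladder_at \<alpha> \<beta> s y k) \<le> C * y powr M * fst (ladder_at \<alpha>' \<beta>' s' (\<mu> * y) k) \<and>
    snd (ladder_at \<alpha> \<beta> s y k) \<le> C * y powr M * snd (ladder_at \<alpha>' \<beta>' s' (\<mu> * y) k)"
proof -
  obtain n0 where n0: "\<alpha> k \<le> \<mu> * \<alpha>' k" "\<beta> k \<le> \<mu> * \<beta>' k" if "k \<ge> n0" for k
    using ev unfolding eventually_sequentially by blast
  \<comment> \<open>At least one rung is needed to make both components of the primed state positive.\<close>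
  define n where "n = Suc n0"
  define C where "C = (fst s + snd s) * (\<Prod>j<n. (1 + \<alpha> j) * (1 + \<beta> j)) + 1"
  define c where "c = min (fst (ladder \<alpha>' \<beta>' s' n)) (snd (ladder \<alpha>' \<beta>' s' n))"
  have prod_nonneg: "0 \<le> (\<Prod>j<n. (1 + \<alpha> j) * (1 + \<beta> j))"
    by (intro prod_nonneg) (simp add: nonneg)
  have C: "C > 0" using prod_nonneg nonneg(3,4) unfolding C_def by (simp add: add_nonneg_pos)
  have c: "c > 0" using ladder_pos[OF pos, of n] by (simp add: c_def n_def)
  have "fst (ladder_at \<alpha> \<beta> s y k) \<le> C / c * y powr (2 * n) * fst (ladder_at \<alpha>' \<beta>' s' (\<mu> * y) k) \<and>
      snd (ladder_at \<alpha> \<beta> s y k) \<le> C / c * y powr (2 * n) * snd (ladder_at \<alpha>' \<beta>' s' (\<mu> * y) k)"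
    if y: "y \<ge> 1" and k: "k \<ge> n" for y k
  proof -
    interpret L: nonneg_ladder "\<lambda>k. y * \<alpha> k" "\<lambda>k. y * \<beta> k" s
      using nonneg y by unfold_locales auto
    let ?s = "ladder_at \<alpha> \<beta> s y n" and ?s' = "ladder_at \<alpha>' \<beta>' s' (\<mu> * y) n"
    let ?D = "C / c * y powr (2 * n)"
    have \<mu>y: "1 \<le> \<mu> * y" using y \<mu> by (metis mult_mono' mult_1 zero_le_one)
    have "c \<le> fst ?s'" "c \<le> snd ?s'"
    proof -
      have "\<alpha>' k \<le> \<mu> * y * \<alpha>' k" "\<beta>' k \<le> \<mu> * y * \<beta>' k" for k
        using mult_right_mono[OF \<mu>y less_imp_le[OF pos(1)]]
          mult_right_mono[OF \<mu>y less_imp_le[OF pos(2)]] by auto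
      then show "c \<le> fst ?s'" "c \<le> snd ?s'"
        using ladder_mono[of \<alpha>' \<beta>' "\<lambda>k. \<mu> * y * \<alpha>' k" "\<lambda>k. \<mu> * y * \<beta>' k" s' s' n] pos
        by (auto simp: c_def less_imp_le min_le_iff_disj)
    qed
    moreover have "0 \<le> ?D" using C c by simp
    ultimately have c_le: "c * ?D \<le> ?D * fst ?s'" "c * ?D \<le> ?D * snd ?s'"
      by (metis mult.commute mult_left_mono)+
    have "fst ?s + snd ?s \<le> (fst s + snd s) * (\<Prod>j<n. (1 + y * \<alpha> j) * (1 + y * \<beta> j))"
      using nonneg y by (intro ladder_sum_le) auto
    also have "\<dots> \<le> (fst s + snd s) * (\<Prod>j<n. y\<^sup>2 * ((1 + \<alpha> j) * (1 + \<beta> j)))"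
    proof (intro mult_left_mono prod_mono conjI)
      fix j
      have "1 + y * \<alpha> j \<le> y * (1 + \<alpha> j)" "1 + y * \<beta> j \<le> y * (1 + \<beta> j)"
        using y by (simp_all add: distrib_left)
      then have "(1 + y * \<alpha> j) * (1 + y * \<beta> j) \<le> (y * (1 + \<alpha> j)) * (y * (1 + \<beta> j))"
        by (rule mult_mono) (use nonneg(1,2)[of j] y in auto)
      then show "(1 + y * \<alpha> j) * (1 + y * \<beta> j) \<le> y\<^sup>2 * ((1 + \<alpha> j) * (1 + \<beta> j))"
        by (simp add: power2_eq_square mult_ac)
    qed (use nonneg y in auto)
    also have "\<dots> = (fst s + snd s) * (\<Prod>j<n. (1 + \<alpha> j) * (1 + \<beta> j)) * y powr (2 * n)"
    proof -
      have "y powr real (2 * n) = (y\<^sup>2) ^ n"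
        using powr_realpow[of y "2 * n"] y by (simp only: power_mult)
      then show ?thesis by (simp only: prod.distrib prod_constant card_lessThan mult_ac)
    qed
    also have "\<dots> \<le> C * y powr (2 * n)" by (intro mult_right_mono) (simp_all add: C_def)
    also have "\<dots> = c * ?D" using c by simp
    finally have start: "fst ?s \<le> ?D * fst ?s'" "snd ?s \<le> ?D * snd ?s'"
      using L.nonneg[of n] c_le by linarith+
    let ?a = "\<lambda>j. y * \<alpha> (n + j)" and ?b = "\<lambda>j. y * \<beta> (n + j)"
    let ?a' = "\<lambda>j. \<mu> * y * \<alpha>' (n + j)" and ?b' = "\<lambda>j. \<mu> * y * \<beta>' (n + j)"
    have le: "?a j \<le> ?a' j" "?b j \<le> ?b' j" for j
      using mult_left_mono[OF n0(1)[of "n + j"], of y] mult_left_mono[OF n0(2)[of "n + j"], of y] y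
      by (simp_all add: n_def mult_ac)
    have "fst (ladder ?a ?b ?s (k - n)) \<le> fst (ladder ?a' ?b' (?D * fst ?s', ?D * snd ?s') (k - n)) \<and>
        snd (ladder ?a ?b ?s (k - n)) \<le> snd (ladder ?a' ?b' (?D * fst ?s', ?D * snd ?s') (k - n))"
      using ladder_mono[of ?a ?b ?a' ?b' ?s "(?D * fst ?s', ?D * snd ?s')" "k - n",
          OF L.coeffs_nonneg(1) L.coeffs_nonneg(2) le]
        start L.nonneg[of n] by (simp only: fst_conv snd_conv simp_thms)
    then show ?thesis
      using k by (simp only: ladder_homogeneous fst_conv snd_conv le_add_diff_inverse
        ladder_shift[of "\<lambda>j. y * \<alpha> j" "\<lambda>j. y * \<beta> j" s n "k - n", symmetric]
        ladder_shift[of "\<lambda>j. \<mu> * y * \<alpha>' j" "\<lambda>j. \<mu> * y * \<beta>' j" s' n "k - n", symmetric])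
  qed
  then have "\<forall>y\<ge>1. \<forall>\<^sub>F k in sequentially.
    fst (ladder_at \<alpha> \<beta> s y k) \<le> C / c * y powr (2 * n) * fst (ladder_at \<alpha>' \<beta>' s' (\<mu> * y) k) \<and>
    snd (ladder_at \<alpha> \<beta> s y k) \<le> C / c * y powr (2 * n) * snd (ladder_at \<alpha>' \<beta>' s' (\<mu> * y) k)"
    unfolding eventually_sequentially by blast
  moreover have "C / c > 0" using C c by simp
  ultimately show ?thesis by blast
qed

locale ladder_family =
  fixes \<alpha> \<beta> :: "nat \<Rightarrow> real" and s :: "real \<times> real"
  assumes coeffs_pos: "\<And>k. 0 < \<alpha> k" "\<And>k. 0 < \<beta> k"
    and coeffs_summable: "summable \<alpha>" "summable \<beta>"
    and start: "0 \<le> fst s" "0 \<le> snd s" "0 < fst s + snd s"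
begin

lemma summable_ladder: "0 \<le> y \<Longrightarrow> summable_ladder (\<lambda>k. y * \<alpha> k) (\<lambda>k. y * \<beta> k) s"
  using coeffs_pos coeffs_summable start
  by unfold_locales (auto intro!: mult_nonneg_nonneg summable_mult intro: less_imp_le)

abbreviation "Ulim y \<equiv> fst (ladder_limits_at \<alpha> \<beta> s y)"
abbreviation "Vlim y \<equiv> snd (ladder_limits_at \<alpha> \<beta> s y)"

lemma limits_mono:
  assumes "0 < x" "x \<le> y"
  shows "Ulim x \<le> Ulim y" "Vlim x \<le> Vlim y"
proof -
  have "x * \<alpha> k \<le> y * \<alpha> k" "x * \<beta> k \<le> y * \<beta> k" for k
    using assms less_imp_le[OF coeffs_pos(1)] less_imp_le[OF coeffs_pos(2)]
    by (auto intro!: mult_right_mono)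
  then show "Ulim x \<le> Ulim y" "Vlim x \<le> Vlim y"
    using ladder_limits_mono[OF summable_ladder summable_ladder, of x y] assms by auto
qed

end

lemma ladder_limits_dominated:
  assumes "ladder_family \<alpha> \<beta> s" "ladder_family \<alpha>' \<beta>' s'"
    and ev: "\<And>\<mu>. \<mu> > 1 \<Longrightarrow> \<forall>\<^sub>F k in sequentially. \<alpha> k \<le> \<mu> * \<alpha>' k \<and> \<beta> k \<le> \<mu> * \<beta>' k"
  shows "growth_dominated (\<lambda>y. fst (ladder_limits_at \<alpha> \<beta> s y)) (\<lambda>y. fst (ladder_limits_at \<alpha>' \<beta>' s' y))"
    "growth_dominated (\<lambda>y. snd (ladder_limits_at \<alpha> \<beta> s y)) (\<lambda>y. snd (ladder_limits_at \<alpha>' \<beta>' s' y))"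
proof -
  interpret L: ladder_family \<alpha> \<beta> s by fact
  interpret L': ladder_family \<alpha>' \<beta>' s' by fact
  have "\<exists>C>0. \<exists>M. (\<forall>\<^sub>F y in at_top. L.Ulim y \<le> C * y powr M * L'.Ulim (\<mu> * y)) \<and>
      (\<forall>\<^sub>F y in at_top. L.Vlim y \<le> C * y powr M * L'.Vlim (\<mu> * y))"
    if \<mu>: "\<mu> > 1" for \<mu>
  proof -
    have "\<exists>C>0. \<exists>M. \<forall>y\<ge>1. \<forall>\<^sub>F k in sequentially.
        fst (ladder_at \<alpha> \<beta> s y k) \<le> C * y powr M * fst (ladder_at \<alpha>' \<beta>' s' (\<mu> * y) k) \<and>
        snd (ladder_at \<alpha> \<beta> s y k) \<le> C * y powr M * snd (ladder_at \<alpha>' \<beta>' s' (\<mu> * y) k)"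
      by (rule ladder_dominated[OF L.coeffs_pos[THEN less_imp_le] L.start(1,2) L'.coeffs_pos L'.start
          less_imp_le[OF \<mu>] ev[OF \<mu>]])
    then obtain C M where C: "C > 0" and le: "\<And>y. y \<ge> 1 \<Longrightarrow> \<forall>\<^sub>F k in sequentially.
        fst (ladder_at \<alpha> \<beta> s y k) \<le> C * y powr M * fst (ladder_at \<alpha>' \<beta>' s' (\<mu> * y) k) \<and>
        snd (ladder_at \<alpha> \<beta> s y k) \<le> C * y powr M * snd (ladder_at \<alpha>' \<beta>' s' (\<mu> * y) k)"
      by blast
    have lim_le: "L.Ulim y \<le> C * y powr M * L'.Ulim (\<mu> * y)"
      "L.Vlim y \<le> C * y powr M * L'.Vlim (\<mu> * y)" if y: "y \<ge> 1" for y
    proof -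
      interpret S: summable_ladder "\<lambda>k. y * \<alpha> k" "\<lambda>k. y * \<beta> k" s
        using y by (intro L.summable_ladder) simp
      interpret S': summable_ladder "\<lambda>k. \<mu> * y * \<alpha>' k" "\<lambda>k. \<mu> * y * \<beta>' k" s'
        using y \<mu> by (intro L'.summable_ladder) simp
      show "L.Ulim y \<le> C * y powr M * L'.Ulim (\<mu> * y)"
        by (rule tendsto_le[OF sequentially_bot tendsto_mult_left[OF S'.tendsto(1)] S.tendsto(1)])
          (rule eventually_mono[OF le[OF y]], blast)
      show "L.Vlim y \<le> C * y powr M * L'.Vlim (\<mu> * y)"
        by (rule tendsto_le[OF sequentially_bot tendsto_mult_left[OF S'.tendsto(2)] S.tendsto(2)])
          (rule eventually_mono[OF le[OF y]], blast)
    qed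
    have "\<forall>\<^sub>F y in at_top. L.Ulim y \<le> C * y powr M * L'.Ulim (\<mu> * y)"
      "\<forall>\<^sub>F y in at_top. L.Vlim y \<le> C * y powr M * L'.Vlim (\<mu> * y)"
      by (rule eventually_mono[OF eventually_ge_at_top[of 1]], erule lim_le)+
    then show ?thesis using C by blast
  qed
  then show "growth_dominated L.Ulim L'.Ulim" "growth_dominated L.Vlim L'.Vlim"
    unfolding growth_dominated_def by blast+
qed

text \<open>Coefficients are indexed from 0, the integers \<open>k\<close> in \<open>k powr - c\<close> from 1.\<close>

definition power_coeff :: "real \<Rightarrow> nat \<Rightarrow> real" where
  "power_coeff c k = real (Suc k) powr - c"

text \<open>The ladder to which all others are compared; its first component is
  \<open>1 + G(y\<^sup>2)\<close>.\<close>

abbreviation model_limits where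
  "model_limits c \<equiv> ladder_limits_at (power_coeff c) (power_coeff c) (1, 0)"

lemma power_coeff_pos: "0 < power_coeff c k" by (simp add: power_coeff_def)

lemma summable_power_coeff: "c > 1 \<Longrightarrow> summable (power_coeff c)"
  unfolding power_coeff_def by (subst summable_Suc_iff) (simp add: summable_real_powr_iff)

lemma ladder_family_power: "c > 1 \<Longrightarrow> 0 < A \<Longrightarrow> 0 < B \<Longrightarrow>
    0 \<le> fst s \<Longrightarrow> 0 \<le> snd s \<Longrightarrow> 0 < fst s + snd s \<Longrightarrow>
    ladder_family (\<lambda>k. A * power_coeff c k) (\<lambda>k. B * power_coeff c k) s"
  by unfold_locales (auto intro!: summable_mult summable_power_coeff simp: power_coeff_pos)

lemma model_family: "c > 1 \<Longrightarrow> ladder_family (power_coeff c) (power_coeff c) (1, 0)"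
  using ladder_family_power[of c 1 1 "(1, 0)"] by simp

text \<open>Either component of the limit is bounded by \<open>y\<close> times the other one, up to constants: so
  the two have the same logarithmic growth.\<close>

lemma model_U_V:
  assumes c: "c > 1" and y: "y \<ge> 1"
  defines "S \<equiv> suminf (power_coeff c)"
  shows "snd (model_limits c y) \<le> S * y * fst (model_limits c y)"
    "fst (model_limits c y) \<le> (1 + S) * y * snd (model_limits c y)"
    "1 \<le> snd (model_limits c y)" "0 \<le> S"
proof -
  interpret ladder_family "power_coeff c" "power_coeff c" "(1, 0)" by (rule model_family[OF c])
  interpret summable_ladder "\<lambda>k. y * power_coeff c k" "\<lambda>k. y * power_coeff c k" "(1, 0)"
    using y by (intro summable_ladder) simp
  show S: "0 \<le> S"
    unfolding S_def by (intro suminf_nonneg coeffs_summable less_imp_le power_coeff_pos)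
  have sum: "(\<Sum>j. y * power_coeff c (j + 0)) = y * S"
    unfolding S_def by (simp add: suminf_mult coeffs_summable)
  show "V \<le> S * y * U" using limit_diff_le(2)[of 0] sum by (simp add: mult_ac)
  have "v (Suc 0) = y" by (simp add: ladder_Suc power_coeff_def)
  then show V: "1 \<le> V" using le_limits(2)[of "Suc 0"] y by simp
  have "U \<le> 1 + S * y * V" using limit_diff_le(1)[of 0] sum by (simp add: mult_ac)
  moreover have "1 \<le> y * V" using V y by (metis mult_mono' mult_1 zero_le_one)
  ultimately show "U \<le> (1 + S) * y * V" by (simp add: algebra_simps)
qed

text \<open>The growth of a ladder depends only on the limits \<open>A\<close> and \<open>B\<close>, and by the change of the
  unit of \<open>v\<close> only on \<open>A * B\<close>.  It depends neither on the start nor on the component.\<close>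

theorem ladder_growth:
  assumes c: "c > 1" and fam: "ladder_family \<alpha> \<beta> s"
    and A: "A > 0" "(\<lambda>k. \<alpha> k * real (Suc k) powr c) \<longlonglongrightarrow> A"
    and B: "B > 0" "(\<lambda>k. \<beta> k * real (Suc k) powr c) \<longlonglongrightarrow> B"
    and F: "F = (\<lambda>y. fst (ladder_limits_at \<alpha> \<beta> s y)) \<or> F = (\<lambda>y. snd (ladder_limits_at \<alpha> \<beta> s y))"
  defines "H \<equiv> \<lambda>y. fst (model_limits c (sqrt (A * B) * y))"
  shows "growth_dominated F H" "growth_dominated H F"
proof -
  let ?\<alpha> = "\<lambda>k. A * power_coeff c k" and ?\<beta> = "\<lambda>k. B * power_coeff c k"
  define \<kappa> where "\<kappa> = sqrt (A * B)"
  \<comment> \<open>The unit of \<open>v\<close> for which both coefficient sequences get the same factor \<open>\<kappa>\<close>.\<close>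
  define m where "m = sqrt (A / B)"
  have \<kappa>: "\<kappa> > 0" and m: "m > 0" using A B by (simp_all add: \<kappa>_def m_def)
  have AB: "A = m * \<kappa>" "B = \<kappa> / m"
    using A B by (simp_all add: \<kappa>_def m_def real_sqrt_mult real_sqrt_divide)
  have fam': "ladder_family ?\<alpha> ?\<beta> (1, 0)" using ladder_family_power[of c A B "(1, 0)"] c A B by simp
  have close: "\<forall>\<^sub>F k in sequentially. f k \<le> \<mu> * (a * power_coeff c k) \<and> a * power_coeff c k \<le> \<mu> * f k"
    if f: "(\<lambda>k. f k * real (Suc k) powr c) \<longlonglongrightarrow> a" "a > 0" and \<mu>: "\<mu> > 1" for f a \<mu>
  proof -
    have "a / \<mu> < a" "a < \<mu> * a" using f(2) \<mu> by (simp_all add: field_simps)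
    then have "\<forall>\<^sub>F k in sequentially. f k * real (Suc k) powr c < \<mu> * a"
      "\<forall>\<^sub>F k in sequentially. a / \<mu> < f k * real (Suc k) powr c"
      using order_tendstoD[OF f(1)] by auto
    then show ?thesis
      by eventually_elim
        (use \<mu> in \<open>simp add: power_coeff_def powr_minus field_simps del: of_nat_Suc\<close>)
  qed
  have ev1: "\<forall>\<^sub>F k in sequentially. \<alpha> k \<le> \<mu> * ?\<alpha> k \<and> \<beta> k \<le> \<mu> * ?\<beta> k" if "\<mu> > 1" for \<mu>
    using close[OF A(2,1) that] close[OF B(2,1) that] by eventually_elim simp
  have ev2: "\<forall>\<^sub>F k in sequentially. ?\<alpha> k \<le> \<mu> * \<alpha> k \<and> ?\<beta> k \<le> \<mu> * \<beta> k" if "\<mu> > 1" for \<mu>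
    using close[OF A(2,1) that] close[OF B(2,1) that] by eventually_elim simp
  have dom: "growth_dominated (\<lambda>y. fst (ladder_limits_at \<alpha> \<beta> s y)) (\<lambda>y. fst (ladder_limits_at ?\<alpha> ?\<beta> (1, 0) y))"
    "growth_dominated (\<lambda>y. snd (ladder_limits_at \<alpha> \<beta> s y)) (\<lambda>y. snd (ladder_limits_at ?\<alpha> ?\<beta> (1, 0) y))"
    "growth_dominated (\<lambda>y. fst (ladder_limits_at ?\<alpha> ?\<beta> (1, 0) y)) (\<lambda>y. fst (ladder_limits_at \<alpha> \<beta> s y))"
    "growth_dominated (\<lambda>y. snd (ladder_limits_at ?\<alpha> ?\<beta> (1, 0) y)) (\<lambda>y. snd (ladder_limits_at \<alpha> \<beta> s y))"
    using ladder_limits_dominated[OF fam fam' ev1] ladder_limits_dominated[OF fam' fam ev2] by simp_all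
  have scaled: "ladder_limits_at ?\<alpha> ?\<beta> (1, 0) y =
      (fst (model_limits c (\<kappa> * y)), m * snd (model_limits c (\<kappa> * y)))" if y: "y > 0" for y
  proof -
    interpret ladder_family "power_coeff c" "power_coeff c" "(1, 0)" by (rule model_family[OF c])
    interpret summable_ladder "\<lambda>k. (\<kappa> * y) * power_coeff c k" "\<lambda>k. (\<kappa> * y) * power_coeff c k" "(1, 0)"
      using y \<kappa> by (intro summable_ladder) simp
    have "ladder_at ?\<alpha> ?\<beta> (1, 0) y k = (u k, m * v k)" for k
      using ladder_scale[of m "\<lambda>k. (\<kappa> * y) * power_coeff c k" "\<lambda>k. (\<kappa> * y) * power_coeff c k" 1 0 k]
        m by (simp add: AB mult_ac)
    then show ?thesis
      using limI[OF tendsto(1)] limI[OF tendsto_mult_left[OF tendsto(2), of m]]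
      by (simp add: ladder_limits_def)
  qed
  define S where "S = suminf (power_coeff c)"
  have S: "S \<ge> 0" using model_U_V(4)[OF c] by (auto simp: S_def)
  have ev: "\<forall>\<^sub>F y in at_top. y > 0 \<and> \<kappa> * y \<ge> 1"
    using eventually_ge_at_top[of "1 / \<kappa>"] eventually_gt_at_top[of 0]
    by eventually_elim (use \<kappa> in \<open>simp add: field_simps\<close>)
  have snd_le: "\<forall>\<^sub>F y in at_top. snd (ladder_limits_at ?\<alpha> ?\<beta> (1, 0) y) \<le> (m * (1 + S) * \<kappa>) * y powr 1 * H y"
    using ev
  proof eventually_elim
    case (elim y)
    have "1 \<le> fst (model_limits c (\<kappa> * y))"
      using summable_ladder.le_limits(1)[OF ladder_family.summable_ladder[OF model_family[OF c]], of "\<kappa> * y" 0]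
        elim by simp
    then have "S * (\<kappa> * y) * fst (model_limits c (\<kappa> * y)) \<le> (1 + S) * (\<kappa> * y) * fst (model_limits c (\<kappa> * y))"
      using elim by (intro mult_right_mono) auto
    then have "snd (model_limits c (\<kappa> * y)) \<le> (1 + S) * (\<kappa> * y) * fst (model_limits c (\<kappa> * y))"
      using model_U_V(1)[OF c, of "\<kappa> * y"] elim by (simp add: S_def)
    from mult_left_mono[OF this, of m]
    have "m * snd (model_limits c (\<kappa> * y)) \<le> (m * (1 + S) * \<kappa>) * y powr 1 * H y"
      using elim m by (simp add: H_def \<kappa>_def[symmetric] mult_ac)
    then show ?case using scaled[of y] elim by simp
  qed
  have snd_ge: "\<forall>\<^sub>F y in at_top. H y \<le> ((1 + S) * \<kappa> / m) * y powr 1 * snd (ladder_limits_at ?\<alpha> ?\<beta> (1, 0) y)"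
    using ev
  proof eventually_elim
    case (elim y)
    have "H y \<le> ((1 + S) * \<kappa> / m) * y powr 1 * (m * snd (model_limits c (\<kappa> * y)))"
      using model_U_V(2)[OF c, of "\<kappa> * y"] elim m by (simp add: H_def S_def \<kappa>_def[symmetric] mult_ac)
    then show ?case using scaled[of y] elim by simp
  qed
  have pos: "m * (1 + S) * \<kappa> > 0" "(1 + S) * \<kappa> / m > 0" using S m \<kappa> by auto
  have fst_le: "\<forall>\<^sub>F y in at_top. fst (ladder_limits_at ?\<alpha> ?\<beta> (1, 0) y) \<le> 1 * y powr 0 * H y"
    and fst_ge: "\<forall>\<^sub>F y in at_top. H y \<le> 1 * y powr 0 * fst (ladder_limits_at ?\<alpha> ?\<beta> (1, 0) y)"
    by (rule eventually_mono[OF ev], simp add: scaled H_def \<kappa>_def)+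
  have "growth_dominated (\<lambda>y. fst (ladder_limits_at \<alpha> \<beta> s y)) H"
    by (rule growth_dominated_poly_right[OF zero_less_one fst_le dom(1)])
  moreover have "growth_dominated (\<lambda>y. snd (ladder_limits_at \<alpha> \<beta> s y)) H"
    by (rule growth_dominated_poly_right[OF pos(1) snd_le dom(2)])
  moreover have "growth_dominated H (\<lambda>y. fst (ladder_limits_at \<alpha> \<beta> s y))"
    by (rule growth_dominated_poly_left[OF zero_less_one fst_ge dom(3)])
  moreover have "growth_dominated H (\<lambda>y. snd (ladder_limits_at \<alpha> \<beta> s y))"
    by (rule growth_dominated_poly_left[OF pos(2) snd_ge dom(4)])
  ultimately show "growth_dominated F H" "growth_dominated H F" using F by auto
qed

section \<open>Order of the model ladder\<close>

text \<open>A substitute for \<open>ln (1 + x) \<le> x\<close> with a smaller power of \<open>x\<close>.  Applied to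
  \<open>x = y * k powr - c\<close> it gives a bound of order \<open>s\<close> in \<open>y\<close>, and the sum over
  \<open>k\<close> converges as long as \<open>c * s > 1\<close>.\<close>

lemma one_plus_le_exp_powr:
  fixes x s :: real
  assumes s: "0 < s" "s \<le> 1" and x: "0 \<le> x"
  shows "1 + x \<le> exp ((1 + 2 / s) * x powr s)"
proof (cases "x \<le> 1")
  case True
  have "x \<le> x powr s"
  proof (cases "x = 0")
    case False
    then show ?thesis using powr_mono'[of s 1 x] s x True by simp
  qed simp
  also have "\<dots> \<le> (1 + 2 / s) * x powr s" using s by (simp add: distrib_right)
  finally show ?thesis
    using exp_ge_add_one_self[of "(1 + 2 / s) * x powr s"] by linarith
next
  case False
  then have x1: "x > 1" by simp
  have "ln (2 * x) \<le> (2 * x) powr s / s" using x1 s by (intro ln_powr_bound) auto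
  also have "\<dots> = 2 powr s * (x powr s / s)" using x1 by (simp add: powr_mult)
  also have "\<dots> \<le> 2 powr 1 * (x powr s / s)" using s by (intro mult_right_mono powr_mono) auto
  also have "\<dots> \<le> (1 + 2 / s) * x powr s" by (simp add: distrib_right)
  finally have "exp (ln (2 * x)) \<le> exp ((1 + 2 / s) * x powr s)" by simp
  then have "2 * x \<le> exp ((1 + 2 / s) * x powr s)" using x1 by simp
  then show ?thesis using x1 by linarith
qed

text \<open>Lower bound: as long as \<open>k powr c \<le> y\<close>, which holds for about \<open>y powr (1 / c)\<close> rungs, every
  rung at least doubles \<open>u\<close>.  Upper bound: the product of the factors
  \<open>(1 + y * k powr - c)\<^sup>2\<close> is estimated factor by factor.\<close>

lemma model_exp_order:
  assumes c: "c > 1"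
  shows "exp_order (1 / c) (\<lambda>y. fst (model_limits c y))"
  unfolding exp_order_def
proof (intro conjI allI impI)
  have "\<forall>\<^sub>F y in at_top. exp (ln 2 / 2 * y powr (1 / c)) \<le> fst (model_limits c y)"
    using eventually_ge_at_top[of "2 powr c"]
  proof eventually_elim
    case (elim y)
    have y: "y > 0" by (rule less_le_trans[OF _ elim]) simp
    interpret ladder_family "power_coeff c" "power_coeff c" "(1, 0)" by (rule model_family[OF c])
    interpret summable_ladder "\<lambda>k. y * power_coeff c k" "\<lambda>k. y * power_coeff c k" "(1, 0)"
      using y by (intro summable_ladder) simp
    define n where "n = nat \<lfloor>y powr (1 / c)\<rfloor>"
    have root: "(y powr (1 / c)) powr c = y" using c y by (simp add: powr_powr)
    have grow: "2 ^ k \<le> u k" if "k \<le> n" for k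
      using that
    proof (induction k)
      case (Suc k)
      have "real (Suc k) \<le> y powr (1 / c)"
        using Suc.prems unfolding n_def by (simp add: le_nat_floor le_nat_iff le_floor_iff)
      then have "real (Suc k) powr c \<le> (y powr (1 / c)) powr c"
        using c by (intro powr_mono2) auto
      then have "1 \<le> y * power_coeff c k"
        unfolding root power_coeff_def by (simp add: powr_minus field_simps del: of_nat_Suc)
      then have ge: "1 * u k \<le> (y * power_coeff c k) * u k"
        using nonneg(1)[of k] by (intro mult_right_mono)
      then have "u k \<le> v (Suc k)" using nonneg(2)[of k] by (simp add: snd_ladder_Suc)
      also have "1 * v (Suc k) \<le> (y * power_coeff c k) * v (Suc k)"
        using nonneg(2)[of "Suc k"] \<open>1 \<le> y * power_coeff c k\<close> by (intro mult_right_mono)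
      finally have "2 * u k \<le> u (Suc k)" by (simp add: fst_ladder_Suc)
      then show ?case using Suc by simp
    qed simp
    have "2 \<le> y powr (1 / c)"
      using powr_mono2[of "1 / c" "2 powr c" y] elim c by (simp add: powr_powr)
    moreover have "y powr (1 / c) - 1 \<le> real n" unfolding n_def by linarith
    ultimately have "y powr (1 / c) / 2 \<le> real n" by linarith
    then have "ln 2 / 2 * y powr (1 / c) \<le> ln 2 * real n"
      using mult_left_mono[of "y powr (1 / c) / 2" "real n" "ln 2"] by simp
    then have "exp (ln 2 / 2 * y powr (1 / c)) \<le> exp (ln 2 * real n)" by simp
    also have "\<dots> = 2 ^ n" by (simp add: exp_of_nat2_mult)
    also have "\<dots> \<le> U" using grow[of n] le_limits(1)[of n] by linarith
    finally show ?case .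
  qed
  then show "\<exists>a>0. \<forall>\<^sub>F y in at_top. exp (a * y powr (1 / c)) \<le> fst (model_limits c y)"
    by (intro exI[of _ "ln 2 / 2"]) simp
next
  fix t assume t: "t > 1 / c"
  define s where "s = min t 1"
  have s: "0 < s" "s \<le> 1" "c * s > 1" "s \<le> t"
    using t c less_trans[of 0 "1 / c" t] by (auto simp: s_def field_simps min_def)
  define K where "K = (1 + 2 / s) * suminf (power_coeff (c * s))"
  have s_pos: "0 < 1 + 2 / s" using s by (simp add: add_pos_pos)
  have K: "K \<ge> 0"
    unfolding K_def using s s_pos
    by (intro mult_nonneg_nonneg suminf_nonneg summable_power_coeff less_imp_le power_coeff_pos) auto
  have "\<forall>\<^sub>F y in at_top. fst (model_limits c y) \<le> exp ((2 * K + 1) * y powr t)"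
    using eventually_ge_at_top[of 1]
  proof eventually_elim
    case (elim y)
    interpret ladder_family "power_coeff c" "power_coeff c" "(1, 0)" by (rule model_family[OF c])
    interpret summable_ladder "\<lambda>k. y * power_coeff c k" "\<lambda>k. y * power_coeff c k" "(1, 0)"
      using elim by (intro summable_ladder) simp
    have "u k \<le> exp (2 * K * y powr s)" for k
    proof -
      have step: "1 + y * power_coeff c j \<le> exp ((1 + 2 / s) * (y powr s * power_coeff (c * s) j))" for j
        using one_plus_le_exp_powr[of s "y * power_coeff c j"] s elim
        by (simp add: power_coeff_def powr_mult powr_powr)
      have "u k \<le> u k + v k" using nonneg[of k] by simp
      also have "\<dots> \<le> (\<Prod>j<k. (1 + y * power_coeff c j) * (1 + y * power_coeff c j))"
        using ladder_sum_le[of "\<lambda>k. y * power_coeff c k" "\<lambda>k. y * power_coeff c k" "(1, 0)" k,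
          OF coeffs_nonneg start_nonneg] by simp
      also have "\<dots> \<le> (\<Prod>j<k. exp ((1 + 2 / s) * (y powr s * power_coeff (c * s) j)) *
          exp ((1 + 2 / s) * (y powr s * power_coeff (c * s) j)))"
        using step coeffs_nonneg(1) by (intro prod_mono conjI mult_mono) (auto intro!: add_nonneg_nonneg)
      also have "\<dots> = exp (2 * ((1 + 2 / s) * (\<Sum>j<k. power_coeff (c * s) j) * y powr s))"
        by (simp add: exp_add[symmetric] exp_sum[symmetric] sum_distrib_left sum_distrib_right mult_ac)
      also have "\<dots> \<le> exp (2 * (K * y powr s))"
        unfolding K_def using s s_pos
        by (intro exp_le_cancel_iff[THEN iffD2] mult_left_mono mult_right_mono sum_le_suminf
            summable_power_coeff) (auto intro: less_imp_le[OF power_coeff_pos])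
      finally show ?thesis by (simp only: mult.assoc)
    qed
    then have "U \<le> exp (2 * K * y powr s)" by (intro LIMSEQ_le_const2[OF tendsto(1)]) auto
    also have "\<dots> \<le> exp ((2 * K + 1) * y powr t)"
      using K s elim by (intro exp_le_cancel_iff[THEN iffD2] mult_mono powr_mono) auto
    finally show ?case .
  qed
  then show "\<exists>C>0. \<forall>\<^sub>F y in at_top. fst (model_limits c y) \<le> exp (C * y powr t)"
    using K by (intro exI[of _ "2 * K + 1"]) simp
qed

section \<open>The series of alternating lists as a ladder\<close>

text \<open>Sums over infinite sets of lists become limits of the ladder by exhausting the set with the
  finite sets of lists whose entries are at most \<open>N\<close>.\<close>

lemma has_sum_exhaustion:
  fixes w :: "'a \<Rightarrow> real"
  assumes nonneg: "\<And>x. x \<in> S \<Longrightarrow> 0 \<le> w x"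
    and fin: "\<And>N. finite (E N)" and mono: "\<And>M N. M \<le> N \<Longrightarrow> E M \<subseteq> E N" and un: "(\<Union>N. E N) = S"
    and lim: "(\<lambda>N. sum w (E N)) \<longlonglongrightarrow> L"
  shows "(w has_sum L) S"
proof -
  have absorb: "\<exists>N. F \<subseteq> E N" if "finite F" "F \<subseteq> S" for F
    using that
  proof (induction F rule: finite_induct)
    case (insert x F)
    then obtain M N where "F \<subseteq> E M" "x \<in> E N" using un by blast
    then have "insert x F \<subseteq> E (max M N)" using mono[of M "max M N"] mono[of N "max M N"] by auto
    then show ?case ..
  qed simp
  have sub: "E N \<subseteq> S" for N using un by blast
  have mono_sum: "incseq (\<lambda>N. sum w (E N))"
    by (intro monoI sum_mono2 fin mono) (use sub nonneg in auto)
  have "sum w F \<le> L" if F: "finite F" "F \<subseteq> S" for F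
  proof -
    obtain N where "F \<subseteq> E N" using absorb F by blast
    then have "sum w F \<le> sum w (E N)" using sub nonneg by (intro sum_mono2 fin) auto
    also have "\<dots> \<le> L" by (rule incseq_le[OF mono_sum lim])
    finally show ?thesis .
  qed
  then have "w summable_on S"
    by (intro nonneg_bdd_above_summable_on nonneg bdd_aboveI[of _ L]) auto
  then have hs: "(w has_sum infsum w S) S" by simp
  have "filterlim E (finite_subsets_at_top S) sequentially"
    unfolding filterlim_finite_subsets_at_top
  proof (intro allI impI)
    fix F assume "finite F \<and> F \<subseteq> S"
    then obtain N where "F \<subseteq> E N" using absorb by blast
    then show "\<forall>\<^sub>F N in sequentially. finite (E N) \<and> F \<subseteq> E N \<and> E N \<subseteq> S"
      unfolding eventually_sequentially using fin sub mono by blast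
  qed
  with hs have "(\<lambda>N. sum w (E N)) \<longlonglongrightarrow> infsum w S"
    unfolding has_sum_def by (rule filterlim_compose)
  then have "infsum w S = L" using lim LIMSEQ_unique by blast
  then show ?thesis using hs by simp
qed

text \<open>Sorts a sum over lists by the power of \<open>r\<close>; the coefficients are then infinite sums over
  lists of a fixed length.\<close>

lemma graded_power_series:
  fixes w :: "'a \<Rightarrow> real" and d :: "'a \<Rightarrow> nat"
  assumes hs: "((\<lambda>x. w x * r ^ d x) has_sum L) S" and r: "r \<noteq> 0"
  shows "(\<lambda>n. infsum w {x \<in> S. d x = n} * r ^ n) sums L"
proof -
  have "bij_betw snd (SIGMA n:UNIV. {x \<in> S. d x = n}) S"
    by (rule bij_betwI[of _ _ _ "\<lambda>x. (d x, x)"]) auto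
  then have "((\<lambda>p. w (snd p) * r ^ d (snd p)) has_sum L) (SIGMA n:UNIV. {x \<in> S. d x = n})"
    using has_sum_reindex_bij_betw[of snd _ S "\<lambda>x. w x * r ^ d x"] hs by blast
  then have Sig: "((\<lambda>p. w (snd p) * r ^ fst p) has_sum L) (SIGMA n:UNIV. {x \<in> S. d x = n})"
    by (rule has_sum_cong[THEN iffD1, rotated]) auto
  have "((\<lambda>x. w (snd (n, x)) * r ^ fst (n, x)) has_sum (infsum w {x \<in> S. d x = n} * r ^ n)) {x \<in> S. d x = n}"
    for n
  proof -
    have "(\<lambda>x. w x * r ^ d x) summable_on {x \<in> S. d x = n}"
      by (rule summable_on_subset_banach[OF has_sum_imp_summable[OF hs]]) simp
    then have "(\<lambda>x. w x * r ^ n) summable_on {x \<in> S. d x = n}"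
      by (rule summable_on_cong[THEN iffD1, rotated]) auto
    then have "w summable_on {x \<in> S. d x = n}" using r by (simp add: summable_on_cmult_left')
    then show ?thesis using has_sum_cmult_left[OF has_sum_infsum, of w _ "r ^ n"] by simp
  qed
  then have "((\<lambda>n. infsum w {x \<in> S. d x = n} * r ^ n) has_sum L) UNIV"
    by (intro has_sum_SigmaD[OF Sig]) auto
  then show ?thesis by (rule has_sum_imp_sums)
qed

lemma max_modulus_eqI:
  assumes le: "\<And>z. cmod z = r \<Longrightarrow> cmod (f z) \<le> M" and w: "cmod w = r" "cmod (f w) = M"
  shows "max_modulus f r = M"
  unfolding max_modulus_def using assms by (intro cSup_eq_maximum) force+

text \<open>With nonnegative coefficients the maximum is attained on the positive half-line.\<close>

lemma max_modulus_nonneg_series: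
  assumes a: "\<And>n. 0 \<le> a n" and sums: "(\<lambda>n. a n * r ^ (n + m)) sums L" and r: "r \<ge> 0"
  shows "max_modulus (\<lambda>z. \<Sum>n. of_real (a n) * z ^ (n + m)) r = L"
proof (rule max_modulus_eqI[where w = "of_real r"])
  have L: "L \<ge> 0" using a r by (intro sums_le[OF _ sums_zero sums]) auto
  have "(\<lambda>n. complex_of_real (a n) * of_real r ^ (n + m)) sums of_real L"
    using sums_of_real[OF sums, where 'a = complex] by simp
  then show "cmod (\<Sum>n. of_real (a n) * of_real r ^ (n + m)) = L"
    using L by (simp add: sums_iff)
  fix z :: complex assume z: "cmod z = r"
  have eq: "(\<lambda>n. cmod (of_real (a n) * z ^ (n + m))) = (\<lambda>n. a n * r ^ (n + m))"
    using z a by (simp add: norm_mult norm_power)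
  have "summable (\<lambda>n. cmod (of_real (a n) * z ^ (n + m)))"
    unfolding eq using sums by (rule sums_summable)
  then show "cmod (\<Sum>n. of_real (a n) * z ^ (n + m)) \<le> L"
    using summable_norm[of "\<lambda>n. of_real (a n) * z ^ (n + m)"] sums unfolding eq by (simp add: sums_iff)
qed (use r in simp)

definition alternating_lists :: "nat list set" where
  "alternating_lists = {k. (\<forall>i < length k. 1 \<le> k ! i) \<and>
     (\<forall>i. Suc i < length k \<longrightarrow> (if even i then k ! i \<le> k ! Suc i else k ! i < k ! Suc i))}"

lemma gamma_indices_eq: "gamma_indices n = {k \<in> alternating_lists. length k = 2 * n}"
  unfolding gamma_indices_def alternating_lists_def by auto

text \<open>Lists are built by appending the largest entry, as the ladder does.  The next two facts
  translate the conditions on list entries into this form.\<close>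

lemma snoc_nth_less: "(\<forall>i<length (k @ [x]). P ((k @ [x]) ! i)) \<longleftrightarrow> (\<forall>i<length k. P (k ! i)) \<and> P x"
  by (auto simp: nth_append less_Suc_eq)

lemma snoc_consecutive:
  "(\<forall>i. Suc i < length (k @ [x]) \<longrightarrow> P i ((k @ [x]) ! i) ((k @ [x]) ! Suc i)) \<longleftrightarrow>
   (\<forall>i. Suc i < length k \<longrightarrow> P i (k ! i) (k ! Suc i)) \<and> (k \<noteq> [] \<longrightarrow> P (length k - 1) (last k) x)"
  (is "?L \<longleftrightarrow> ?R")
proof
  assume L: ?L
  show ?R
  proof (intro conjI allI impI)
    show "P i (k ! i) (k ! Suc i)" if "Suc i < length k" for i
      using L[rule_format, of i] that by (simp add: nth_append)
    show "P (length k - 1) (last k) x" if "k \<noteq> []"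
      using L[rule_format, of "length k - 1"] that by (simp add: nth_append last_conv_nth)
  qed
next
  assume R: ?R
  show ?L
  proof (intro allI impI)
    fix i assume i: "Suc i < length (k @ [x])"
    show "P i ((k @ [x]) ! i) ((k @ [x]) ! Suc i)"
    proof (cases "Suc i < length k")
      case False
      then have "i = length k - 1" "k \<noteq> []" using i by auto
      then show ?thesis using R by (simp add: nth_append last_conv_nth)
    qed (use R in \<open>simp add: nth_append\<close>)
  qed
qed

lemma alternating_snoc:
  "k @ [x] \<in> alternating_lists \<longleftrightarrow> k \<in> alternating_lists \<and> 1 \<le> x \<and>
     (k \<noteq> [] \<longrightarrow> (if odd (length k) then last k \<le> x else last k < x))"
  unfolding alternating_lists_def mem_Collect_eq
    snoc_nth_less[of _ _ "\<lambda>y. 1 \<le> y"] snoc_consecutive[of _ _ "\<lambda>i y z. if even i then y \<le> z else y < z"]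
  by (cases "k = []") auto

lemma alternating_le_last: "k \<in> alternating_lists \<Longrightarrow> y \<in> set k \<Longrightarrow> y \<le> last k"
proof (induction k rule: rev_induct)
  case (snoc x k)
  then show ?case by (cases "k = []") (auto simp: alternating_snoc split: if_splits)
qed simp

lemma alternating_pos: "k \<in> alternating_lists \<Longrightarrow> y \<in> set k \<Longrightarrow> 1 \<le> y"
  unfolding alternating_lists_def by (auto simp: in_set_conv_nth)

definition even_lists :: "nat \<Rightarrow> nat list set" where
  "even_lists N = {k \<in> alternating_lists. even (length k) \<and> set k \<subseteq> {..N}}"

definition odd_lists :: "nat \<Rightarrow> nat list set" where
  "odd_lists N = {k \<in> alternating_lists. odd (length k) \<and> set k \<subseteq> {..N}}"

lemma even_lists_0: "even_lists 0 = {[]}" and odd_lists_0: "odd_lists 0 = {}"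
proof -
  have empty: "k = []" if "k \<in> alternating_lists" "set k \<subseteq> {..0}" for k
    using that alternating_pos[OF that(1), of "hd k"] hd_in_set[of k] by fastforce
  have "[] \<in> alternating_lists" by (simp add: alternating_lists_def)
  moreover have "k = []" if "k \<in> even_lists 0" for k
    using that empty[of k] unfolding even_lists_def by simp
  ultimately show "even_lists 0 = {[]}" by (auto simp: even_lists_def)
  have "k \<notin> odd_lists 0" for k
    using empty[of k] unfolding odd_lists_def by auto
  then show "odd_lists 0 = {}" by blast
qed

text \<open>The two decompositions mirror the two lines of the ladder recursion.  A list of odd length
  that ends with \<open>Suc N\<close> extends an even one by a strict inequality, so the old set appears; a list
  of even length extends an odd one by a weak inequality, so the new set appears.\<close>

lemma odd_lists_Suc: "odd_lists (Suc N) = odd_lists N \<union> (\<lambda>k. k @ [Suc N]) ` even_lists N"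
proof (intro equalityI subsetI)
  fix l assume l: "l \<in> odd_lists (Suc N)"
  show "l \<in> odd_lists N \<union> (\<lambda>k. k @ [Suc N]) ` even_lists N"
  proof (cases l rule: rev_cases)
    case Nil
    with l show ?thesis by (simp add: odd_lists_def)
  next
    case (snoc k x)
    have "y \<le> x" if "y \<in> set l" for y using alternating_le_last[of l y] l that snoc by (auto simp: odd_lists_def)
    moreover have "k \<in> even_lists N" if "x = Suc N"
    proof -
      have "y \<le> N" if "y \<in> set k" for y
        using alternating_le_last[of k y] l that \<open>x = Suc N\<close> unfolding snoc odd_lists_def
        by (cases "k = []") (auto simp: alternating_snoc)
      then show ?thesis using l unfolding snoc by (auto simp: odd_lists_def even_lists_def alternating_snoc)
    qed
    moreover have "x \<le> Suc N" using l snoc by (auto simp: odd_lists_def)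
    ultimately show ?thesis using l snoc by (cases "x = Suc N") (fastforce simp: odd_lists_def)+
  qed
next
  fix l assume "l \<in> odd_lists N \<union> (\<lambda>k. k @ [Suc N]) ` even_lists N"
  then show "l \<in> odd_lists (Suc N)"
  proof
    assume "l \<in> (\<lambda>k. k @ [Suc N]) ` even_lists N"
    then obtain k where k: "l = k @ [Suc N]" "k \<in> even_lists N" by blast
    then have "last k < Suc N" if "k \<noteq> []" using last_in_set[OF that] by (force simp: even_lists_def)
    then show ?thesis using k by (auto simp: odd_lists_def even_lists_def alternating_snoc)
  qed (auto simp: odd_lists_def)
qed

lemma even_lists_Suc: "even_lists (Suc N) = even_lists N \<union> (\<lambda>k. k @ [Suc N]) ` odd_lists (Suc N)"
proof (intro equalityI subsetI)
  fix l assume l: "l \<in> even_lists (Suc N)"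
  show "l \<in> even_lists N \<union> (\<lambda>k. k @ [Suc N]) ` odd_lists (Suc N)"
  proof (cases l rule: rev_cases)
    case Nil
    with l show ?thesis by (simp add: even_lists_def)
  next
    case (snoc k x)
    have "y \<le> x" if "y \<in> set l" for y using alternating_le_last[of l y] l that snoc by (auto simp: even_lists_def)
    moreover have "k \<in> odd_lists (Suc N)"
      using l unfolding snoc by (auto simp: odd_lists_def even_lists_def alternating_snoc)
    moreover have "x \<le> Suc N" using l snoc by (auto simp: even_lists_def)
    ultimately show ?thesis using l snoc by (cases "x = Suc N") (fastforce simp: even_lists_def)+
  qed
next
  fix l assume "l \<in> even_lists N \<union> (\<lambda>k. k @ [Suc N]) ` odd_lists (Suc N)"
  then show "l \<in> even_lists (Suc N)"
  proof
    assume "l \<in> (\<lambda>k. k @ [Suc N]) ` odd_lists (Suc N)"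
    then obtain k where k: "l = k @ [Suc N]" "k \<in> odd_lists (Suc N)" by blast
    then have "k \<noteq> []" by (auto simp: odd_lists_def)
    then have "last k \<le> Suc N" using last_in_set[of k] k(2) by (force simp: odd_lists_def)
    then show ?thesis using k by (auto simp: odd_lists_def even_lists_def alternating_snoc)
  qed (auto simp: even_lists_def)
qed

lemma finite_even_odd_lists: "finite (even_lists N)" "finite (odd_lists N)"
proof (induction N)
  case (Suc N)
  show "finite (odd_lists (Suc N))" using Suc by (simp add: odd_lists_Suc)
  then show "finite (even_lists (Suc N))" using Suc by (simp add: even_lists_Suc)
qed (simp_all add: even_lists_0 odd_lists_0)

lemma ladder_eq_alternating_sums:
  fixes f :: "nat \<Rightarrow> real"
  defines "W \<equiv> \<lambda>k. \<Prod>i<length k. f (k ! i)"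
  shows "ladder (\<lambda>n. f (Suc n)) (\<lambda>n. f (Suc n)) (1, 0) N = (sum W (even_lists N), sum W (odd_lists N))"
proof (induction N)
  case 0
  show ?case by (simp add: even_lists_0 odd_lists_0 W_def)
next
  case (Suc N)
  have W_snoc: "W (k @ [x]) = f x * W k" for k x by (simp add: W_def nth_append mult.commute)
  have new: "sum W (A \<union> (\<lambda>k. k @ [Suc N]) ` B) = sum W A + f (Suc N) * sum W B"
    if "finite A" "finite B" "\<And>k. k \<in> A \<Longrightarrow> set k \<subseteq> {..N}" for A B
  proof -
    have "A \<inter> (\<lambda>k. k @ [Suc N]) ` B = {}" using that(3) by force
    then have "sum W (A \<union> (\<lambda>k. k @ [Suc N]) ` B) = sum W A + sum W ((\<lambda>k. k @ [Suc N]) ` B)"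
      using that by (intro sum.union_disjoint) auto
    also have "sum W ((\<lambda>k. k @ [Suc N]) ` B) = f (Suc N) * sum W B"
      by (subst sum.reindex) (auto simp: inj_on_def W_snoc sum_distrib_left)
    finally show ?thesis .
  qed
  have "sum W (odd_lists (Suc N)) = sum W (odd_lists N) + f (Suc N) * sum W (even_lists N)"
    unfolding odd_lists_Suc by (intro new finite_even_odd_lists) (auto simp: odd_lists_def)
  moreover have "sum W (even_lists (Suc N)) = sum W (even_lists N) + f (Suc N) * sum W (odd_lists (Suc N))"
    unfolding even_lists_Suc by (intro new finite_even_odd_lists) (auto simp: even_lists_def)
  ultimately show ?case using Suc by (simp add: prod_eq_iff ladder_Suc)
qed

lemma gamma_coeff_nonneg: "0 \<le> gamma_coeff n p"
  unfolding gamma_coeff_def by (intro infsum_nonneg) simp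

lemma gamma_coeff_0: "gamma_coeff 0 p = 1"
proof -
  have "gamma_indices 0 = {[]}" by (auto simp: gamma_indices_def)
  then show ?thesis by (simp add: gamma_coeff_def)
qed

lemma gamma_sums:
  assumes c: "c > 1" and r: "r > 0"
  shows "(\<lambda>n. gamma_coeff n (2 * c) * r ^ n) sums fst (model_limits c (sqrt r))"
proof -
  interpret ladder_family "power_coeff c" "power_coeff c" "(1, 0)" by (rule model_family[OF c])
  interpret summable_ladder "\<lambda>k. sqrt r * power_coeff c k" "\<lambda>k. sqrt r * power_coeff c k" "(1, 0)"
    using r by (intro summable_ladder) simp
  define f where "f x = sqrt r * real x powr - c" for x
  define W where "W k = (\<Prod>i<length k. f (k ! i))" for k
  define w where "w k = (\<Prod>i<length k. real (k ! i)) powr - c" for k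
  let ?S = "{k \<in> alternating_lists. even (length k)}"
  have W: "W k = w k * r ^ (length k div 2)" if "even (length k)" for k
  proof -
    have "sqrt r ^ length k = r ^ (length k div 2)"
      using that r by (auto elim!: evenE simp: power_mult)
    then show ?thesis
      unfolding W_def f_def w_def by (simp add: prod.distrib prod_powr_distrib)
  qed
  have "u = (\<lambda>N. sum W (even_lists N))"
    using ladder_eq_alternating_sums[of f] by (simp add: W_def f_def power_coeff_def)
  then have lim: "(\<lambda>N. sum W (even_lists N)) \<longlonglongrightarrow> U" using tendsto(1) by simp
  have "(W has_sum U) ?S"
  proof (rule has_sum_exhaustion[OF _ _ _ _ lim])
    show "(\<Union>N. even_lists N) = ?S"
    proof
      show "?S \<subseteq> (\<Union>N. even_lists N)"
        by (auto simp: even_lists_def intro!: alternating_le_last)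
    qed (auto simp: even_lists_def)
  qed (use r in \<open>auto simp: W_def f_def even_lists_def finite_even_odd_lists[unfolded even_lists_def]
    intro!: prod_nonneg\<close>)
  then have "((\<lambda>k. w k * r ^ (length k div 2)) has_sum U) ?S"
    by (rule has_sum_cong[THEN iffD1, rotated]) (simp add: W)
  from graded_power_series[OF this] r
  have "(\<lambda>n. infsum w {k \<in> ?S. length k div 2 = n} * r ^ n) sums U" by simp
  moreover have "infsum w {k \<in> ?S. length k div 2 = n} = gamma_coeff n (2 * c)" for n
  proof -
    have "{k \<in> ?S. length k div 2 = n} = gamma_indices n" unfolding gamma_indices_eq by auto
    then show ?thesis
      unfolding gamma_coeff_def w_def by (auto intro!: infsum_cong simp: gamma_indices_def)
  qed
  ultimately show ?thesis by simp
qed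

lemma max_modulus_G:
  assumes c: "c > 1" and r: "r > 0"
  shows "max_modulus (G_fun (2 * c)) r = fst (model_limits c (sqrt r)) - 1"
proof -
  have "(\<lambda>n. gamma_coeff (n + 1) (2 * c) * r ^ (n + 1)) sums (fst (model_limits c (sqrt r)) - 1)"
    using sums_split_initial_segment[OF gamma_sums[OF assms], of 1] by (simp add: gamma_coeff_0)
  from max_modulus_nonneg_series[OF gamma_coeff_nonneg this] r show ?thesis
    unfolding G_fun_def by simp
qed

section \<open>The series of increasing lists as a ladder\<close>

definition increasing_lists :: "nat list set" where
  "increasing_lists = {k. (\<forall>i < length k. 1 \<le> k ! i) \<and>
     (\<forall>i. Suc i < length k \<longrightarrow> k ! i < k ! Suc i)}"

lemma zeta_indices_eq: "zeta_indices n = {k \<in> increasing_lists. length k = n}"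
  unfolding zeta_indices_def increasing_lists_def by auto

lemma increasing_snoc:
  "k @ [x] \<in> increasing_lists \<longleftrightarrow> k \<in> increasing_lists \<and> 1 \<le> x \<and> (k \<noteq> [] \<longrightarrow> last k < x)"
  unfolding increasing_lists_def mem_Collect_eq
    snoc_nth_less[of _ _ "\<lambda>y. 1 \<le> y"] snoc_consecutive[of _ _ "\<lambda>_ y z. y < z"]
  by auto

lemma increasing_le_last: "k \<in> increasing_lists \<Longrightarrow> y \<in> set k \<Longrightarrow> y \<le> last k"
proof (induction k rule: rev_induct)
  case (snoc x k)
  then show ?case by (cases "k = []") (auto simp: increasing_snoc)
qed simp

definition nonempty_increasing :: "nat \<Rightarrow> nat list set" where
  "nonempty_increasing N = {k \<in> increasing_lists. k \<noteq> [] \<and> set k \<subseteq> {..N}}"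

lemma nonempty_increasing_0: "nonempty_increasing 0 = {}"
proof -
  have "k \<notin> nonempty_increasing 0" for k
    by (cases k rule: rev_cases) (auto simp: nonempty_increasing_def increasing_snoc)
  then show ?thesis by blast
qed

lemma nonempty_increasing_Suc:
  "nonempty_increasing (Suc N) =
     nonempty_increasing N \<union> (\<lambda>k. k @ [Suc N]) ` insert [] (nonempty_increasing N)"
proof (intro equalityI subsetI)
  fix l assume l: "l \<in> nonempty_increasing (Suc N)"
  then obtain k x where kx: "l = k @ [x]"
    by (cases l rule: rev_cases) (auto simp: nonempty_increasing_def)
  have "y \<le> x" if "y \<in> set l" for y
    using increasing_le_last[of l y] l that kx by (auto simp: nonempty_increasing_def)
  moreover have "k \<in> insert [] (nonempty_increasing N)" if "x = Suc N"
  proof -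
    have "y \<le> N" if "y \<in> set k" for y
      using increasing_le_last[of k y] l that \<open>x = Suc N\<close> unfolding kx nonempty_increasing_def
      by (cases "k = []") (auto simp: increasing_snoc)
    then show ?thesis using l unfolding kx by (auto simp: nonempty_increasing_def increasing_snoc)
  qed
  moreover have "x \<le> Suc N" using l kx by (auto simp: nonempty_increasing_def)
  ultimately show "l \<in> nonempty_increasing N \<union> (\<lambda>k. k @ [Suc N]) ` insert [] (nonempty_increasing N)"
    using l kx by (cases "x = Suc N") (fastforce simp: nonempty_increasing_def)+
next
  fix l assume "l \<in> nonempty_increasing N \<union> (\<lambda>k. k @ [Suc N]) ` insert [] (nonempty_increasing N)"
  then show "l \<in> nonempty_increasing (Suc N)"
  proof
    assume "l \<in> (\<lambda>k. k @ [Suc N]) ` insert [] (nonempty_increasing N)"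
    then obtain k where k: "l = k @ [Suc N]" "k \<in> insert [] (nonempty_increasing N)" by blast
    have "last k < Suc N" if "k \<noteq> []"
    proof -
      have "set k \<subseteq> {..N}" using that k(2) by (auto simp: nonempty_increasing_def)
      from subsetD[OF this last_in_set[OF that]] show ?thesis by simp
    qed
    moreover have "[] \<in> increasing_lists" by (simp add: increasing_lists_def)
    ultimately show ?thesis using k by (auto simp: nonempty_increasing_def increasing_snoc)
  qed (auto simp: nonempty_increasing_def)
qed

lemma finite_nonempty_increasing: "finite (nonempty_increasing N)"
  by (induction N) (simp_all add: nonempty_increasing_0 nonempty_increasing_Suc)

text \<open>The gap factors come from the constant coefficients \<open>\<beta> = 1\<close>: between two uses of \<open>f\<close>
  the first component grows linearly, with slope the second one, so a list contributes to it
  in proportion to the distance of its last entry from \<open>N + 1\<close>.\<close>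

lemma ladder_eq_increasing_sums:
  fixes f :: "nat \<Rightarrow> real"
  defines "W \<equiv> \<lambda>k. (\<Prod>i<length k - 1. real (k ! Suc i) - real (k ! i)) * (\<Prod>i<length k. f (k ! i))"
  shows "ladder (\<lambda>n. f (Suc n)) (\<lambda>_. 1) (1, 0) N =
    (1 + (\<Sum>k\<in>nonempty_increasing N. W k * (real N + 1 - real (last k))),
     sum W (nonempty_increasing N))"
proof (induction N)
  case 0
  show ?case by (simp add: nonempty_increasing_0)
next
  case (Suc N)
  let ?A = "nonempty_increasing N" and ?s = "\<lambda>k. k @ [Suc N]"
  have W_single: "W [x] = f x" for x by (simp add: W_def)
  have W_snoc: "W (k @ [x]) = f x * (W k * (real x - real (last k)))" if k: "k \<noteq> []" for k x
  proof -
    obtain m where m: "length k = Suc m" using k by (cases k) auto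
    have "(\<Prod>i<length (k @ [x]) - 1. real ((k @ [x]) ! Suc i) - real ((k @ [x]) ! i)) =
        (\<Prod>i<m. real (k ! Suc i) - real (k ! i)) * (real x - real (last k))"
      using k by (simp add: m nth_append last_conv_nth)
    moreover have "(\<Prod>i<length (k @ [x]). f ((k @ [x]) ! i)) = (\<Prod>i<length k. f (k ! i)) * f x"
      by (simp add: nth_append)
    ultimately show ?thesis unfolding W_def by (simp add: m mult_ac)
  qed
  have sum_new: "sum g (nonempty_increasing (Suc N)) = sum g ?A + (g [Suc N] + (\<Sum>k\<in>?A. g (?s k)))"
    for g :: "nat list \<Rightarrow> real"
  proof -
    have "?A \<inter> ?s ` insert [] ?A = {}" by (force simp: nonempty_increasing_def)
    then have "sum g (nonempty_increasing (Suc N)) = sum g ?A + sum g (?s ` insert [] ?A)"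
      unfolding nonempty_increasing_Suc by (intro sum.union_disjoint) (auto simp: finite_nonempty_increasing)
    also have "sum g (?s ` insert [] ?A) = sum (g \<circ> ?s) (insert [] ?A)"
      by (rule sum.reindex) (auto simp: inj_on_def)
    also have "\<dots> = g [Suc N] + (\<Sum>k\<in>?A. g (?s k))"
      by (subst sum.insert) (rule finite_nonempty_increasing, auto simp: nonempty_increasing_def)
    finally show ?thesis .
  qed
  have new: "(\<Sum>k\<in>?A. W (?s k)) = f (Suc N) * (\<Sum>k\<in>?A. W k * (real N + 1 - real (last k)))"
    unfolding sum_distrib_left
    by (intro sum.cong refl) (subst W_snoc, auto simp: nonempty_increasing_def)
  have v: "sum W (nonempty_increasing (Suc N)) =
      sum W ?A + f (Suc N) * (1 + (\<Sum>k\<in>?A. W k * (real N + 1 - real (last k))))"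
    by (simp add: sum_new[of W] new W_single distrib_left)
  have "(\<Sum>k\<in>nonempty_increasing (Suc N). W k * (real (Suc N) + 1 - real (last k))) =
      (\<Sum>k\<in>?A. W k * (real N + 1 - real (last k))) + sum W ?A + (W [Suc N] + (\<Sum>k\<in>?A. W (?s k)))"
    by (simp add: sum_new sum.distrib[symmetric] algebra_simps)
  also have "\<dots> = (\<Sum>k\<in>?A. W k * (real N + 1 - real (last k))) + sum W (nonempty_increasing (Suc N))"
    by (simp add: sum_new[of W])
  finally show ?case using Suc v by (simp add: prod_eq_iff ladder_Suc)
qed

text \<open>Two ladders with the same product of coefficients \<open>\<alpha> * \<beta>\<close>: the symmetric one, which
  belongs to \<open>G\<close>, and the one with \<open>\<beta> = 1\<close>, which belongs to \<open>Z\<close>.  Measuring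
  \<open>Z.v\<close> in the varying unit \<open>y * a k\<close> would turn one recursion into the other, up to the
  factors \<open>a k / a (Suc k)\<close>.  Their product telescopes, so the total error is
  one factor \<open>a k\<close>, and because \<open>a\<close> decreases it has a sign, which gives the
  bounds below by induction.\<close>

locale string_comparison =
  fixes a :: "nat \<Rightarrow> real" and y :: real
  assumes a_pos: "\<And>k. 0 < a k" and a_dec: "\<And>k. a (Suc k) \<le> a k" and a_le_1: "a 0 \<le> 1" and y: "y \<ge> 0"
begin

sublocale G: nonneg_ladder "\<lambda>k. y * a k" "\<lambda>k. y * a k" "(1, 0)"
  using y by unfold_locales (auto intro!: mult_nonneg_nonneg less_imp_le[OF a_pos])

sublocale Z: nonneg_ladder "\<lambda>k. (y * a k)\<^sup>2" "\<lambda>_. 1" "(1, 0)"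
  by unfold_locales auto

lemma upper: "a k * Z.u k \<le> G.u k \<and> Z.v k \<le> y * G.v k"
proof (induction k)
  case 0
  show ?case using a_le_1 by simp
next
  case (Suc k)
  have "(y * a k)\<^sup>2 * Z.u k = y\<^sup>2 * a k * (a k * Z.u k)" by (simp add: power2_eq_square)
  also have "\<dots> \<le> y\<^sup>2 * a k * G.u k" using Suc a_pos[of k] by (intro mult_left_mono) auto
  finally have v: "Z.v (Suc k) \<le> y * G.v (Suc k)"
    using Suc by (simp add: snd_ladder_Suc distrib_left power2_eq_square mult_ac)
  have "a (Suc k) * Z.u (Suc k) \<le> a k * Z.u (Suc k)"
    using a_dec Z.nonneg by (intro mult_right_mono)
  also have "\<dots> = a k * Z.u k + a k * Z.v (Suc k)" by (simp add: fst_ladder_Suc distrib_left)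
  also have "\<dots> \<le> G.u k + a k * (y * G.v (Suc k))"
    using Suc v a_pos[of k] by (intro add_mono mult_left_mono) auto
  also have "\<dots> = G.u (Suc k)" by (simp add: fst_ladder_Suc mult_ac)
  finally show ?case using v by blast
qed

lemma lower: "G.u k \<le> Z.u k \<and> y * a k * G.v k \<le> Z.v k"
proof (induction k)
  case (Suc k)
  have "y * a k * G.v (Suc k) = y * a k * G.v k + (y * a k)\<^sup>2 * G.u k"
    by (simp add: snd_ladder_Suc distrib_left power2_eq_square)
  also have "\<dots> \<le> Z.v k + (y * a k)\<^sup>2 * Z.u k"
    using Suc by (intro add_mono mult_left_mono) auto
  also have "\<dots> = Z.v (Suc k)" by (simp add: snd_ladder_Suc)
  finally have v: "y * a k * G.v (Suc k) \<le> Z.v (Suc k)" .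
  have "y * a (Suc k) * G.v (Suc k) \<le> y * a k * G.v (Suc k)"
    using a_dec y G.nonneg by (intro mult_right_mono mult_left_mono) auto
  moreover have "G.u (Suc k) \<le> Z.u (Suc k)" using Suc v by (simp add: fst_ladder_Suc)
  ultimately show ?case using v by simp
qed simp

end

lemma power_coeff_dec: "0 \<le> c \<Longrightarrow> j \<le> k \<Longrightarrow> power_coeff c k \<le> power_coeff c j"
  unfolding power_coeff_def by (intro powr_mono2') auto

lemma power_coeff_le_1: "0 \<le> c \<Longrightarrow> power_coeff c k \<le> 1"
  using power_coeff_dec[of c 0 k] by (simp add: power_coeff_def)

text \<open>This is \<open>Z(y\<^sup>2)\<close> completed by the term of index 1.\<close>

definition zeta_limit :: "real \<Rightarrow> real \<Rightarrow> real" where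
  "zeta_limit c y = lim (\<lambda>k. snd (ladder (\<lambda>k. (y * power_coeff c k)\<^sup>2) (\<lambda>_. 1) (1, 0) k))"

lemma string_comparison_power: "c > 1 \<Longrightarrow> y \<ge> 0 \<Longrightarrow> string_comparison (power_coeff c) y"
  by unfold_locales (auto simp: power_coeff_pos power_coeff_le_1 intro!: power_coeff_dec)

lemma
  assumes c: "c > 1" and y: "y \<ge> 0"
  shows zeta_limit_tendsto:
      "(\<lambda>k. snd (ladder (\<lambda>k. (y * power_coeff c k)\<^sup>2) (\<lambda>_. 1) (1, 0) k)) \<longlonglongrightarrow> zeta_limit c y"
    and zeta_limit_upper: "zeta_limit c y \<le> y * snd (model_limits c y)"
    and zeta_limit_lower: "y * power_coeff c k * snd (ladder_at (power_coeff c) (power_coeff c) (1, 0) y k) \<le> zeta_limit c y"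
proof -
  interpret ladder_family "power_coeff c" "power_coeff c" "(1, 0)" by (rule model_family[OF c])
  interpret L: summable_ladder "\<lambda>k. y * power_coeff c k" "\<lambda>k. y * power_coeff c k" "(1, 0)"
    using y by (intro summable_ladder) simp
  interpret S: string_comparison "power_coeff c" y by (rule string_comparison_power[OF c y])
  have bound: "S.Z.v k \<le> y * L.V" for k
  proof -
    have "S.Z.v k \<le> y * L.v k" using S.upper by blast
    also have "\<dots> \<le> y * L.V" by (intro mult_left_mono L.le_limits y)
    finally show ?thesis .
  qed
  have "convergent S.Z.v"
    using incseq_convergent[OF S.Z.incseq(2), of "y * L.V"] bound by (metis convergentI)
  then show lim: "S.Z.v \<longlonglongrightarrow> zeta_limit c y"
    unfolding zeta_limit_def by (simp add: convergent_LIMSEQ_iff)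
  show "zeta_limit c y \<le> y * L.V" using bound by (intro LIMSEQ_le_const2[OF lim]) auto
  have "y * power_coeff c k * L.v k \<le> S.Z.v k" using S.lower by blast
  also have "\<dots> \<le> zeta_limit c y" by (rule incseq_le[OF S.Z.incseq(2) lim])
  finally show "y * power_coeff c k * L.v k \<le> zeta_limit c y" .
qed

text \<open>The lower comparison loses the factor \<open>n powr - c\<close> at rung \<open>n\<close>, so it cannot be used in the
  limit.  But the symmetric ladder has reached half of its limit at a rung \<open>n\<close> that is only
  polynomial in \<open>y\<close>, and there the loss is polynomial.\<close>

lemma model_V_le_zeta_limit:
  assumes c: "c > 1"
  shows "\<exists>C>0. \<exists>M. \<forall>y\<ge>1. snd (model_limits c y) \<le> C * y powr M * zeta_limit c y"
proof -
  \<comment> \<open>The tail of the coefficients from \<open>n\<close> on is at most a constant times \<open>n powr - \<delta>\<close>.\<close>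
  define \<delta> where "\<delta> = (c - 1) / 2"
  have \<delta>: "\<delta> > 0" "c - \<delta> > 1" using c by (simp_all add: \<delta>_def field_simps)
  define S where "S = suminf (power_coeff c)"
  define S' where "S' = suminf (power_coeff (c - \<delta>))"
  define K where "K = 2 * (1 + S) * S'"
  have S: "S \<ge> 0" using model_U_V(4)[OF c] by (auto simp: S_def)
  have S': "S' > 0"
    unfolding S'_def by (intro suminf_pos summable_power_coeff \<delta> power_coeff_pos)
  have K: "K > 0" using S S' by (simp add: K_def)
  have "snd (model_limits c y) \<le> (2 * (K powr (1 / \<delta>) + 2) powr c) * y powr (2 * c / \<delta>) * zeta_limit c y"
    if y: "y \<ge> 1" for y
  proof -
    interpret ladder_family "power_coeff c" "power_coeff c" "(1, 0)" by (rule model_family[OF c])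
    interpret summable_ladder "\<lambda>k. y * power_coeff c k" "\<lambda>k. y * power_coeff c k" "(1, 0)"
      using y by (intro summable_ladder) simp
    \<comment> \<open>Chosen to make the tail below at most half of the limit.\<close>
    define n where "n = nat \<lceil>(K * y\<^sup>2) powr (1 / \<delta>)\<rceil>"
    have "(K * y\<^sup>2) powr (1 / \<delta>) \<le> real (Suc n)" unfolding n_def by linarith
    then have "((K * y\<^sup>2) powr (1 / \<delta>)) powr \<delta> \<le> real (Suc n) powr \<delta>"
      using \<delta> by (intro powr_mono2) auto
    then have n_ge: "K * y\<^sup>2 * power_coeff \<delta> n \<le> 1"
      using \<delta> K y by (simp add: powr_powr power_coeff_def powr_minus field_simps del: of_nat_Suc)
    have V: "V \<ge> 1" "U \<le> (1 + S) * y * V"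
      using model_U_V[OF c y] by (simp_all add: S_def)
    have tail: "(\<Sum>j. power_coeff c (j + n)) \<le> power_coeff \<delta> n * S'"
    proof -
      have le: "power_coeff c (j + n) \<le> power_coeff \<delta> n * power_coeff (c - \<delta>) j" for j
      proof -
        have "power_coeff c (j + n) = power_coeff \<delta> (j + n) * power_coeff (c - \<delta>) (j + n)"
          by (simp add: power_coeff_def powr_add[symmetric])
        also have "\<dots> \<le> power_coeff \<delta> n * power_coeff (c - \<delta>) j"
          using \<delta> by (intro mult_mono power_coeff_dec less_imp_le[OF power_coeff_pos]) auto
        finally show ?thesis .
      qed
      have "(\<Sum>j. power_coeff c (j + n)) \<le> (\<Sum>j. power_coeff \<delta> n * power_coeff (c - \<delta>) j)"
        using le \<delta> c by (intro suminf_le summable_mult summable_power_coeff)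
          (auto simp: summable_iff_shift summable_power_coeff)
      also have "\<dots> = power_coeff \<delta> n * S'"
        unfolding S'_def using \<delta> by (intro suminf_mult summable_power_coeff)
      finally show ?thesis .
    qed
    have "V - v n \<le> U * (\<Sum>j. y * power_coeff c (j + n))" by (rule limit_diff_le(2))
    also have "(\<Sum>j. y * power_coeff c (j + n)) = y * (\<Sum>j. power_coeff c (j + n))"
      using c by (intro suminf_mult) (simp add: summable_iff_shift summable_power_coeff)
    also have "U * (y * (\<Sum>j. power_coeff c (j + n))) \<le> ((1 + S) * y * V) * (y * (power_coeff \<delta> n * S'))"
      using V tail y S limits_nonneg c
      by (intro mult_mono) (auto intro!: suminf_nonneg mult_nonneg_nonneg less_imp_le[OF power_coeff_pos]
        simp: summable_iff_shift summable_power_coeff)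
    also have "\<dots> = (K * y\<^sup>2 * power_coeff \<delta> n) * (V / 2)"
      by (simp add: K_def power2_eq_square mult_ac)
    also have "\<dots> \<le> 1 * (V / 2)" using n_ge V by (intro mult_right_mono) auto
    finally have half: "V \<le> 2 * v n" by simp
    have z: "y * power_coeff c n * v n \<le> zeta_limit c y" using zeta_limit_lower[OF c, of y n] y by simp
    have v0: "0 \<le> v n" by (rule nonneg)
    have "power_coeff c n * v n \<le> y * (power_coeff c n * v n)"
      using mult_right_mono[OF y, of "power_coeff c n * v n"] v0 power_coeff_pos[of c n] by simp
    with z have "power_coeff c n * v n \<le> zeta_limit c y" by (simp add: mult.assoc)
    then have vn: "v n \<le> real (Suc n) powr c * zeta_limit c y"
      by (simp add: power_coeff_def powr_minus field_simps del: of_nat_Suc)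
    have z0: "0 \<le> zeta_limit c y"
      using \<open>power_coeff c n * v n \<le> zeta_limit c y\<close> v0 power_coeff_pos[of c n]
      by (meson less_imp_le mult_nonneg_nonneg order_trans)
    have "real (Suc n) \<le> (K * y\<^sup>2) powr (1 / \<delta>) + 2" unfolding n_def by (simp add: ceiling_le_iff) linarith
    also have "(K * y\<^sup>2) powr (1 / \<delta>) = K powr (1 / \<delta>) * y powr (2 / \<delta>)"
      using K y by (simp add: powr_mult powr_powr flip: powr_numeral)
    also have "K powr (1 / \<delta>) * y powr (2 / \<delta>) + 2 \<le> (K powr (1 / \<delta>) + 2) * y powr (2 / \<delta>)"
      using ge_one_powr_ge_zero[OF y, of "2 / \<delta>"] \<delta> by (simp add: distrib_right)
    finally have "real (Suc n) powr c \<le> ((K powr (1 / \<delta>) + 2) * y powr (2 / \<delta>)) powr c"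
      using c by (intro powr_mono2) auto
    also have "\<dots> = (K powr (1 / \<delta>) + 2) powr c * y powr (2 * c / \<delta>)"
      using y by (simp add: powr_mult powr_powr)
    finally have "real (Suc n) powr c * zeta_limit c y \<le> (K powr (1 / \<delta>) + 2) powr c * y powr (2 * c / \<delta>) * zeta_limit c y"
      using z0 by (intro mult_right_mono)
    with half vn show ?thesis by simp
  qed
  moreover have "2 * (K powr (1 / \<delta>) + 2) powr c > 0"
    by (smt (verit) powr_gt_zero powr_ge_zero)
  ultimately show ?thesis by blast
qed

lemma zeta_coeff_nonneg: "0 \<le> zeta_coeff n p"
  unfolding zeta_coeff_def
proof (intro infsum_nonneg mult_nonneg_nonneg prod_nonneg)
  fix k i assume "k \<in> zeta_indices n" "i \<in> {..<n - 1}"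
  then have "k ! i < k ! Suc i" by (auto simp: zeta_indices_def)
  then show "0 \<le> real (k ! Suc i) - real (k ! i)" by simp
qed simp

lemma zeta_sums:
  assumes c: "c > 1" and r: "r > 0"
  shows "(\<lambda>n. zeta_coeff (n + 1) (2 * c) * r ^ (n + 1)) sums zeta_limit c (sqrt r)"
proof -
  define f where "f x = r * real x powr - (2 * c)" for x
  define D where "D k = (\<Prod>i<length k - 1. real (k ! Suc i) - real (k ! i))" for k
  define W where "W k = D k * (\<Prod>i<length k. f (k ! i))" for k
  define w where "w k = D k * (\<Prod>i<length k. real (k ! i)) powr - (2 * c)" for k
  let ?S = "{k \<in> increasing_lists. k \<noteq> []}"
  have D: "0 \<le> D k" if "k \<in> increasing_lists" for k
    unfolding D_def
  proof (rule prod_nonneg)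
    fix i assume "i \<in> {..<length k - 1}"
    then have "k ! i < k ! Suc i" using that by (auto simp: increasing_lists_def)
    then show "0 \<le> real (k ! Suc i) - real (k ! i)" by simp
  qed
  have W: "W k = w k * r ^ length k" for k
    unfolding W_def f_def w_def by (simp add: prod.distrib prod_powr_distrib)
  have "(sqrt r * power_coeff c k)\<^sup>2 = f (Suc k)" for k
  proof -
    have "(real (Suc k) powr - c)\<^sup>2 = real (Suc k) powr - (2 * c)"
      by (simp add: power2_eq_square flip: powr_add)
    then show ?thesis using r by (simp add: f_def power_coeff_def power_mult_distrib)
  qed
  then have "(\<lambda>N. snd (ladder (\<lambda>k. (sqrt r * power_coeff c k)\<^sup>2) (\<lambda>_. 1) (1, 0) N)) =
      (\<lambda>N. sum W (nonempty_increasing N))"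
    using ladder_eq_increasing_sums[of f] by (simp add: W_def D_def)
  then have lim: "(\<lambda>N. sum W (nonempty_increasing N)) \<longlonglongrightarrow> zeta_limit c (sqrt r)"
    using zeta_limit_tendsto[OF c, of "sqrt r"] r by simp
  have "(W has_sum zeta_limit c (sqrt r)) ?S"
  proof (rule has_sum_exhaustion[OF _ _ _ _ lim])
    show "(\<Union>N. nonempty_increasing N) = ?S"
    proof
      show "?S \<subseteq> (\<Union>N. nonempty_increasing N)"
        by (auto simp: nonempty_increasing_def intro!: increasing_le_last)
    qed (auto simp: nonempty_increasing_def)
    show "finite (nonempty_increasing N)" for N by (rule finite_nonempty_increasing)
    show "nonempty_increasing M \<subseteq> nonempty_increasing N" if "M \<le> N" for M N
      using that by (auto simp: nonempty_increasing_def)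
    show "0 \<le> W k" if "k \<in> ?S" for k
      using that r D[of k] unfolding W_def f_def by (auto intro!: mult_nonneg_nonneg prod_nonneg)
  qed
  then have "((\<lambda>k. w k * r ^ length k) has_sum zeta_limit c (sqrt r)) ?S"
    by (rule has_sum_cong[THEN iffD1, rotated]) (simp add: W)
  from graded_power_series[OF this] r
  have "(\<lambda>n. infsum w {k \<in> ?S. length k = n} * r ^ n) sums zeta_limit c (sqrt r)" by simp
  from sums_split_initial_segment[OF this, of 1]
  have "(\<lambda>n. infsum w {k \<in> ?S. length k = n + 1} * r ^ (n + 1)) sums
      (zeta_limit c (sqrt r) - infsum w {k \<in> ?S. length k = 0} * r ^ 0)" by simp
  moreover have "{k \<in> ?S. length k = 0} = {}" by auto
  moreover have "infsum w {k \<in> ?S. length k = n + 1} = zeta_coeff (n + 1) (2 * c)" for n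
  proof -
    have "{k \<in> ?S. length k = n + 1} = zeta_indices (n + 1)" unfolding zeta_indices_eq by auto
    then show ?thesis
      unfolding zeta_coeff_def w_def D_def by (auto intro!: infsum_cong simp: zeta_indices_def)
  qed
  ultimately show ?thesis by simp
qed

lemma max_modulus_Z:
  assumes c: "c > 1" and r: "r > 0"
  shows "max_modulus (Z_fun (2 * c)) r = zeta_limit c (sqrt r) - zeta_coeff 1 (2 * c) * r"
proof -
  have "(\<lambda>n. zeta_coeff (n + 2) (2 * c) * r ^ (n + 2)) sums
      (zeta_limit c (sqrt r) - zeta_coeff 1 (2 * c) * r)"
    using sums_split_initial_segment[OF zeta_sums[OF assms], of 1] by (simp add: numeral_2_eq_2)
  from max_modulus_nonneg_series[OF zeta_coeff_nonneg this] r show ?thesis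
    unfolding Z_fun_def by simp
qed

section \<open>Growth of the comparison functions\<close>

text \<open>Constant and linear terms of the series are invisible.  They are at most a multiple of
  \<open>y\<^sup>2\<close>, which is eventually less than half of \<open>E y\<close>.\<close>

lemma growth_dominated_minus:
  assumes mono: "\<And>x y. 0 < x \<Longrightarrow> x \<le> y \<Longrightarrow> H x \<le> H y" and ord: "exp_order \<rho> H" and \<rho>: "\<rho> > 0"
    and C: "C > 0" "\<forall>\<^sub>F y in at_top. E y \<le> C * y powr M * H y"
    and D: "D > 0" "\<forall>\<^sub>F y in at_top. H y \<le> D * y powr N * E y"
    and F: "\<forall>\<^sub>F y in at_top. F y \<le> E y \<and> E y \<le> F y + a * y powr 2" and a: "a \<ge> 0"
  shows "growth_dominated F H" "growth_dominated H F"
proof -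
  have refl: "growth_dominated H H" by (rule growth_dominated_refl) (rule mono)
  have "\<forall>\<^sub>F y in at_top. F y \<le> C * y powr M * H y"
    using C(2) F by eventually_elim linarith
  then show "growth_dominated F H" by (rule growth_dominated_poly_left[OF C(1) _ refl])
  obtain e where e: "e > 0" and lower: "\<forall>\<^sub>F y in at_top. exp (e * y powr \<rho>) \<le> H y"
    using ord unfolding exp_order_def by blast
  have "\<forall>\<^sub>F y in at_top. 2 * a * y powr 2 * (D * y powr N) \<le> exp (e * y powr \<rho>)"
  proof (cases "a = 0")
    case False
    then have "a > 0" using a by simp
    then show ?thesis using e \<rho> D(1) by real_asymp
  qed simp
  with lower D(2) F eventually_gt_at_top[of 0]
  have "\<forall>\<^sub>F y in at_top. H y \<le> (2 * D) * y powr N * F y"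
  proof eventually_elim
    case (elim y)
    have pos: "D * y powr N > 0" using D(1) elim by simp
    have "2 * a * y powr 2 * (D * y powr N) \<le> D * y powr N * E y"
      using elim by linarith
    then have "2 * a * y powr 2 * (D * y powr N) \<le> E y * (D * y powr N)"
      by (simp only: mult.commute[of "E y"])
    then have "2 * a * y powr 2 \<le> E y" using pos by (rule mult_right_le_imp_le)
    then have "E y \<le> 2 * F y" using elim by simp
    then have "D * y powr N * E y \<le> D * y powr N * (2 * F y)" using pos by (intro mult_left_mono) auto
    then show ?case using elim by (simp add: mult_ac)
  qed
  then show "growth_dominated H F"
    by (rule growth_dominated_poly_right[OF _ _ refl, rotated]) (use D(1) in simp)
qed

lemma model_mono: "c > 1 \<Longrightarrow> 0 < x \<Longrightarrow> x \<le> y \<Longrightarrow> fst (model_limits c x) \<le> fst (model_limits c y)"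
  by (rule ladder_family.limits_mono(1)[OF model_family])

lemma growth_G:
  assumes c: "c > 1"
  defines "T \<equiv> exp_type (1 / c) (\<lambda>y. fst (model_limits c y))"
  shows "growth_type (G_fun (2 * c)) = T"
proof -
  let ?H = "\<lambda>y. fst (model_limits c y)" and ?F = "\<lambda>y. fst (model_limits c y) - 1"
  have c': "1 / c > 0" using c by simp
  have triv: "\<forall>\<^sub>F y in at_top. ?H y \<le> 1 * y powr 0 * ?H y"
    using eventually_gt_at_top[of 0] by eventually_elim simp
  have "\<forall>\<^sub>F y in at_top. ?F y \<le> ?H y \<and> ?H y \<le> ?F y + 1 * y powr 2"
    using eventually_ge_at_top[of 1]
    by eventually_elim (simp add: one_le_power)
  note dom = growth_dominated_minus[OF model_mono[OF c] model_exp_order[OF c] c'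
      zero_less_one triv zero_less_one triv this zero_le_one]
  have ord: "exp_order (1 / c) ?F" by (rule exp_order_similar[OF model_exp_order[OF c] dom c'])
  have "growth_type (G_fun (2 * c)) = exp_type (1 / c / 2) (\<lambda>r. ?F (sqrt r))"
    by (rule growth_order_type_eq(2)[OF max_modulus_G[OF c] exp_order_sqrt[OF ord]]) (use c in simp_all)
  also have "\<dots> = exp_type (1 / c) ?F" by (rule exp_type_sqrt)
  also have "\<dots> = T" unfolding T_def by (rule exp_type_similar[OF model_exp_order[OF c] dom c'])
  finally show ?thesis .
qed

lemma growth_Z:
  assumes c: "c > 1"
  defines "T \<equiv> exp_type (1 / c) (\<lambda>y. fst (model_limits c y))"
  shows "growth_type (Z_fun (2 * c)) = T"
proof -
  let ?H = "\<lambda>y. fst (model_limits c y)"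
  define F where "F y = zeta_limit c y - zeta_coeff 1 (2 * c) * y\<^sup>2" for y
  define S where "S = suminf (power_coeff c)"
  have c': "1 / c > 0" using c by simp
  have S: "S \<ge> 0" using model_U_V(4)[OF c] by (auto simp: S_def)
  have upper: "\<forall>\<^sub>F y in at_top. zeta_limit c y \<le> (S + 1) * y powr 2 * ?H y"
    using eventually_ge_at_top[of 1]
  proof eventually_elim
    case (elim y)
    have H1: "1 \<le> ?H y"
      using summable_ladder.le_limits(1)[OF ladder_family.summable_ladder[OF model_family[OF c]], of y 0]
        elim by simp
    have "zeta_limit c y \<le> y * snd (model_limits c y)"
      using zeta_limit_upper[OF c] elim by simp
    also have "\<dots> \<le> y * (S * y * ?H y)"
      unfolding S_def using elim by (intro mult_left_mono model_U_V(1)[OF c]) auto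
    also have "\<dots> = S * (y powr 2 * ?H y)" using elim by (simp add: power2_eq_square)
    also have "\<dots> \<le> (S + 1) * (y powr 2 * ?H y)" using H1 by (intro mult_right_mono) auto
    finally show ?case by (simp only: mult.assoc)
  qed
  obtain C M where C: "C > 0" and CM: "\<And>y. y \<ge> 1 \<Longrightarrow> snd (model_limits c y) \<le> C * y powr M * zeta_limit c y"
    using model_V_le_zeta_limit[OF c] by blast
  have lower: "\<forall>\<^sub>F y in at_top. ?H y \<le> ((1 + S) * C) * y powr (1 + M) * zeta_limit c y"
    using eventually_ge_at_top[of 1]
  proof eventually_elim
    case (elim y)
    have "?H y \<le> (1 + S) * y * snd (model_limits c y)"
      unfolding S_def by (rule model_U_V(2)[OF c elim])
    also have "\<dots> \<le> (1 + S) * y * (C * y powr M * zeta_limit c y)"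
      using elim S by (intro mult_left_mono CM) auto
    finally show ?case using elim by (simp add: powr_add mult_ac)
  qed
  have "\<forall>\<^sub>F y in at_top. F y \<le> zeta_limit c y \<and> zeta_limit c y \<le> F y + zeta_coeff 1 (2 * c) * y powr 2"
    using eventually_gt_at_top[of 0]
    by eventually_elim (simp add: F_def zeta_coeff_nonneg)
  moreover have "S + 1 > 0" "(1 + S) * C > 0" using S C by auto
  ultimately have dom: "growth_dominated F ?H" "growth_dominated ?H F"
    using growth_dominated_minus[OF model_mono[OF c] model_exp_order[OF c] c' _ upper _ lower _ zeta_coeff_nonneg]
    by simp_all
  have ord: "exp_order (1 / c) F" by (rule exp_order_similar[OF model_exp_order[OF c] dom c'])
  have "max_modulus (Z_fun (2 * c)) r = F (sqrt r)" if "r > 0" for r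
    using max_modulus_Z[OF c that] that by (simp add: F_def)
  then have "growth_type (Z_fun (2 * c)) = exp_type (1 / c / 2) (\<lambda>r. F (sqrt r))"
    by (rule growth_order_type_eq(2)[OF _ exp_order_sqrt[OF ord]]) (use c in simp_all)
  also have "\<dots> = exp_type (1 / c) F" by (rule exp_type_sqrt)
  also have "\<dots> = T" unfolding T_def by (rule exp_type_similar[OF model_exp_order[OF c] dom c'])
  finally show ?thesis .
qed

section \<open>Symmetric Jacobi recurrences as ladders\<close>

lemma orth_poly_of_real:
  "orth_poly a b n (of_real x :: complex) = of_real (orth_poly a b n x)"
  by (induction n rule: induct_nat_012) auto

lemma second_kind_poly_of_real:
  "second_kind_poly a b n (of_real x :: complex) = of_real (second_kind_poly a b n x)"
  by (induction n rule: induct_nat_012) auto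

locale symmetric_jacobi =
  fixes a b :: "nat \<Rightarrow> real"
  assumes a_zero: "\<And>n. a n = 0" and b_pos: "\<And>n. b n > 0"
begin

abbreviation p :: "nat \<Rightarrow> real" where "p n \<equiv> orth_poly a b n 0"
abbreviation q :: "nat \<Rightarrow> real" where "q n \<equiv> second_kind_poly a b n 0"

lemma at_zero_Suc_Suc:
  "b (Suc n) * p (Suc (Suc n)) = - b n * p n" "b (Suc n) * q (Suc (Suc n)) = - b n * q n"
  using b_pos[of "Suc n"] by (simp_all add: a_zero field_simps)

lemma at_zero_1: "p (Suc 0) = 0" "q (Suc 0) = 1 / b 0"
  by (simp_all add: a_zero)

lemma p_odd: "p (Suc (2 * k)) = 0" and q_even: "q (2 * k) = 0"
  by (induction k) (simp_all add: a_zero)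

lemma wronskian: "b n * (p n * q (Suc n) - p (Suc n) * q n) = 1"
proof (induction n)
  case 0
  show ?case using b_pos[of 0] by (simp add: a_zero)
next
  case (Suc n)
  have "b (Suc n) * (p (Suc n) * q (Suc (Suc n)) - p (Suc (Suc n)) * q (Suc n)) =
      p (Suc n) * (b (Suc n) * q (Suc (Suc n))) - (b (Suc n) * p (Suc (Suc n))) * q (Suc n)"
    by (simp only: right_diff_distrib mult_ac)
  also have "\<dots> = b n * (p n * q (Suc n) - p (Suc n) * q n)"
    unfolding at_zero_Suc_Suc by (simp add: algebra_simps)
  finally show ?case using Suc by simp
qed

end

text \<open>Any solution \<open>r\<close> of the three-term recurrence, together with its sums against the two
  solutions at zero.  The initial values \<open>x0 = 0\<close>, \<open>y0 = -1\<close> yield the polynomials of the first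
  kind with \<open>X\<close> and \<open>Y\<close> the partial sums of \<open>D\<close> and \<open>B\<close>; the values \<open>x0 = 1\<close>,
  \<open>y0 = 0\<close> yield those of the second kind with the partial sums of \<open>C\<close> and \<open>A\<close>.\<close>

locale recurrence_solution = symmetric_jacobi +
  fixes z x0 y0 :: complex and r :: "nat \<Rightarrow> complex"
  assumes r_0: "r 0 = - y0" and r_1: "r (Suc 0) = (x0 + z * r 0) / of_real (b 0)"
    and r_Suc_Suc: "\<And>n. r (Suc (Suc n)) = (z * r (Suc n) - of_real (b n) * r n) / of_real (b (Suc n))"
begin

definition X :: "nat \<Rightarrow> complex" where "X n = x0 + z * (\<Sum>k<n. of_real (p k) * r k)"
definition Y :: "nat \<Rightarrow> complex" where "Y n = y0 + z * (\<Sum>k<n. of_real (q k) * r k)"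

lemma X_Suc: "X (Suc n) = X n + z * of_real (p n) * r n"
  and Y_Suc: "Y (Suc n) = Y n + z * of_real (q n) * r n"
  by (simp_all add: X_def Y_def algebra_simps)

text \<open>Variation of constants, with the parameter zero as the unperturbed recurrence: the
  solution at \<open>z\<close> is a combination of the two solutions at zero with coefficients whose
  increments are proportional to \<open>z\<close>.\<close>

lemma r_eq: "r n = of_real (q n) * X n - of_real (p n) * Y n"
proof (induction n rule: induct_nat_012)
  case 0
  show ?case by (simp add: r_0 Y_def)
next
  case 1
  show ?case
    by (simp add: r_1 X_def at_zero_1 del: orth_poly.simps(2) second_kind_poly.simps(2))
next
  case (ge2 n)
  let ?b = "complex_of_real (b n)" and ?b' = "complex_of_real (b (Suc n))"
  have b: "?b \<noteq> 0" "?b' \<noteq> 0" using b_pos[of n] b_pos[of "Suc n"] by auto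
  have rec: "?b' * of_real (p (Suc (Suc n))) = - ?b * of_real (p n)"
    "?b' * of_real (q (Suc (Suc n))) = - ?b * of_real (q n)"
    using at_zero_Suc_Suc[of n] by (metis of_real_minus of_real_mult)+
  have w: "?b * (of_real (p n) * of_real (q (Suc n)) - of_real (p (Suc n)) * of_real (q n)) = 1"
    using wronskian[of n] by (metis of_real_1 of_real_diff of_real_mult)
  let ?r' = "r (Suc n)"
  have "?b' * (of_real (q (Suc (Suc n))) * X (Suc (Suc n)) - of_real (p (Suc (Suc n))) * Y (Suc (Suc n)))
      = (?b' * of_real (q (Suc (Suc n)))) * X (Suc (Suc n)) - (?b' * of_real (p (Suc (Suc n)))) * Y (Suc (Suc n))"
    by (simp only: right_diff_distrib mult.assoc)
  also have "\<dots> = - ?b * (of_real (q n) * X n - of_real (p n) * Y n)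
      + z * ?r' * (?b * (of_real (p n) * of_real (q (Suc n)) - of_real (p (Suc n)) * of_real (q n)))"
    unfolding rec X_Suc Y_Suc
    by (simp add: algebra_simps del: orth_poly.simps(2,3) second_kind_poly.simps(2,3))
  also have "\<dots> = - ?b * r n + z * ?r'" unfolding w ge2(1)[symmetric] by simp
  also have "\<dots> = ?b' * r (Suc (Suc n))" using b by (simp add: r_Suc_Suc)
  finally show ?case using b by simp
qed

abbreviation "\<alpha> k \<equiv> (p (2 * k))\<^sup>2"
abbreviation "\<beta> k \<equiv> (q (Suc (2 * k)))\<^sup>2"

text \<open>In the symmetric case one of the two solutions at zero vanishes at each index.  Inserting the
  representation of \<open>r\<close> into the sums then closes them up to a ladder in \<open>X\<close> and \<open>Y\<close>,
  with coefficients \<open>\<alpha>\<close> and \<open>\<beta>\<close>, except that the two steps have opposite signs.\<close>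

lemma r_even: "r (2 * k) = - of_real (p (2 * k)) * Y (2 * k)"
  and r_odd: "r (Suc (2 * k)) = of_real (q (Suc (2 * k))) * X (Suc (2 * k))"
  by (subst r_eq, simp add: q_even p_odd)+

lemma X_step: "X (2 * Suc k) = X (2 * k) - z * of_real (\<alpha> k) * Y (2 * k)"
  by (simp add: X_Suc p_odd r_even power2_eq_square)

lemma Y_step: "Y (2 * Suc k) = Y (2 * k) + z * of_real (\<beta> k) * X (2 * Suc k)"
  by (simp add: X_Suc Y_Suc q_even p_odd r_odd power2_eq_square)

abbreviation "bound \<equiv> ladder_at \<alpha> \<beta> (cmod y0, cmod x0) (cmod z)"

lemma norm_le_bound: "cmod (Y (2 * k)) \<le> fst (bound k) \<and> cmod (X (2 * k)) \<le> snd (bound k)"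
proof (induction k)
  case (Suc k)
  have "cmod (X (2 * Suc k)) \<le> cmod (X (2 * k)) + cmod (z * of_real (\<alpha> k) * Y (2 * k))"
    unfolding X_step by (rule norm_triangle_ineq4)
  also have "\<dots> \<le> snd (bound k) + cmod z * \<alpha> k * fst (bound k)"
    using Suc by (intro add_mono) (auto simp: norm_mult norm_power intro!: mult_left_mono)
  finally have X: "cmod (X (2 * Suc k)) \<le> snd (bound (Suc k))" by (simp add: snd_ladder_Suc)
  have "cmod (Y (2 * Suc k)) \<le> cmod (Y (2 * k)) + cmod (z * of_real (\<beta> k) * X (2 * Suc k))"
    unfolding Y_step by (rule norm_triangle_ineq)
  also have "\<dots> \<le> fst (bound k) + cmod z * \<beta> k * snd (bound (Suc k))"
    using Suc X by (intro add_mono) (auto simp: norm_mult norm_power simp del: mult_Suc_right intro!: mult_left_mono)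
  finally show ?case using X by (simp add: fst_ladder_Suc)
qed (simp add: X_def Y_def)

text \<open>The increments of \<open>X\<close> and \<open>Y\<close> are dominated by those of the ladder.  This gives
  the absolute convergence of the series.\<close>

lemma partial_norms_le:
  "cmod y0 + (\<Sum>k<2 * n. cmod (z * (of_real (q k) * r k))) \<le> fst (bound n) \<and>
   cmod x0 + (\<Sum>k<2 * n. cmod (z * (of_real (p k) * r k))) \<le> snd (bound n)"
proof (induction n)
  case (Suc n)
  have "cmod (z * (of_real (p (2 * n)) * r (2 * n))) = cmod z * \<alpha> n * cmod (Y (2 * n))"
    by (simp add: r_even norm_mult power2_eq_square)
  also have "\<dots> \<le> cmod z * \<alpha> n * fst (bound n)" using norm_le_bound[of n] by (intro mult_left_mono) auto
  finally have 1: "cmod x0 + (\<Sum>k<2 * Suc n. cmod (z * (of_real (p k) * r k))) \<le> snd (bound (Suc n))"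
    using Suc by (simp add: p_odd snd_ladder_Suc)
  have "X (Suc (2 * n)) = X (2 * Suc n)" by (simp add: X_Suc p_odd)
  then have "cmod (z * (of_real (q (Suc (2 * n))) * r (Suc (2 * n)))) = cmod z * \<beta> n * cmod (X (2 * Suc n))"
    by (simp add: r_odd norm_mult power2_eq_square)
  also have "\<dots> \<le> cmod z * \<beta> n * snd (bound (Suc n))"
    using norm_le_bound[of "Suc n"] by (intro mult_left_mono) auto
  finally have "cmod y0 + (\<Sum>k<2 * Suc n. cmod (z * (of_real (q k) * r k))) \<le> fst (bound (Suc n))"
    using Suc by (simp add: q_even fst_ladder_Suc)
  with 1 show ?case by blast
qed simp

text \<open>The opposite signs of the two steps disappear on the imaginary axis.  The phases of \<open>X\<close> and \<open>Y\<close> differ by a quarter turn at the start.  Multiplication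
  by \<open>z = \<i> * t\<close> preserves this, so no cancellation occurs and the estimate by the triangle
  inequality is an equality.\<close>

lemma imaginary_axis:
  assumes z: "z = \<i> * of_real t" and t: "t \<ge> 0"
    and \<omega>: "x0 = \<omega> * of_real (cmod x0)" "y0 = \<i> * \<omega> * of_real (cmod y0)"
  shows "X (2 * k) = \<omega> * of_real (snd (bound k)) \<and> Y (2 * k) = \<i> * \<omega> * of_real (fst (bound k))"
proof (induction k)
  case 0
  show ?case using \<omega> by (simp add: X_def Y_def)
next
  case (Suc k)
  have zt: "cmod (\<i> * complex_of_real t) = t" using t by (simp add: norm_mult)
  have X: "X (2 * Suc k) = \<omega> * of_real (snd (bound (Suc k)))"
    using Suc unfolding X_step snd_ladder_Suc by (simp add: zt z algebra_simps)
  then have "Y (2 * Suc k) = \<i> * \<omega> * of_real (fst (bound (Suc k)))"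
    using Suc unfolding Y_step fst_ladder_Suc by (simp add: zt z algebra_simps)
  with X show ?case by blast
qed

lemma limits:
  assumes z: "z \<noteq> 0" and summable: "summable \<alpha>" "summable \<beta>"
  defines "L \<equiv> ladder_limits_at \<alpha> \<beta> (cmod y0, cmod x0) (cmod z)"
    and "Xlim \<equiv> x0 + z * (\<Sum>k. of_real (p k) * r k)"
    and "Ylim \<equiv> y0 + z * (\<Sum>k. of_real (q k) * r k)"
  shows "cmod Xlim \<le> snd L" "cmod Ylim \<le> fst L"
    and "\<lbrakk>z = \<i> * of_real t; t \<ge> 0; x0 = \<omega> * of_real (cmod x0); y0 = \<i> * \<omega> * of_real (cmod y0); cmod \<omega> = 1\<rbrakk>
      \<Longrightarrow> cmod Xlim = snd L \<and> cmod Ylim = fst L"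
proof -
  interpret B: summable_ladder "\<lambda>k. cmod z * \<alpha> k" "\<lambda>k. cmod z * \<beta> k" "(cmod y0, cmod x0)"
    using summable by unfold_locales (auto intro: summable_mult)
  have even_sub: "strict_mono (\<lambda>n::nat. 2 * n)" by (auto simp: strict_mono_def)
  have conv: "(\<lambda>n. w0 + z * (\<Sum>k<2 * n. f k)) \<longlonglongrightarrow> w0 + z * suminf f"
    if "\<And>n. (\<Sum>k<2 * n. cmod (z * f k)) \<le> K" for f :: "nat \<Rightarrow> complex" and w0 K
  proof -
    have "(\<Sum>k<n. cmod (z * f k)) \<le> K" for n
      using order_trans[OF sum_mono2[of "{..<2 * n}" "{..<n}" "\<lambda>k. cmod (z * f k)"] that[of n]] by auto
    then have "summable (\<lambda>k. cmod (z * f k))" by (intro summableI_nonneg_bounded) auto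
    then have "summable (\<lambda>k. z * f k)" by (rule summable_norm_cancel)
    from this z have "summable f" by (rule summable_mult_D)
    then have "(\<lambda>n. \<Sum>k<2 * n. f k) \<longlonglongrightarrow> suminf f"
      using LIMSEQ_subseq_LIMSEQ[OF summable_LIMSEQ even_sub] by (simp add: o_def)
    then show ?thesis by (intro tendsto_intros)
  qed
  have X: "(\<lambda>n. X (2 * n)) \<longlonglongrightarrow> Xlim"
    unfolding X_def Xlim_def
  proof (rule conv[of _ "snd L"])
    fix n show "(\<Sum>k<2 * n. cmod (z * (of_real (p k) * r k))) \<le> snd L"
      using partial_norms_le[of n] B.le_limits(2)[of n] norm_ge_zero[of x0] unfolding L_def by linarith
  qed
  have Y: "(\<lambda>n. Y (2 * n)) \<longlonglongrightarrow> Ylim"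
    unfolding Y_def Ylim_def
  proof (rule conv[of _ "fst L"])
    fix n show "(\<Sum>k<2 * n. cmod (z * (of_real (q k) * r k))) \<le> fst L"
      using partial_norms_le[of n] B.le_limits(1)[of n] norm_ge_zero[of y0] unfolding L_def by linarith
  qed
  show "cmod Xlim \<le> snd L" "cmod Ylim \<le> fst L"
    unfolding L_def using norm_le_bound
    by (auto intro!: LIMSEQ_le[OF tendsto_norm[OF X] B.tendsto(2)] LIMSEQ_le[OF tendsto_norm[OF Y] B.tendsto(1)])
  show "cmod Xlim = snd L \<and> cmod Ylim = fst L"
    if "z = \<i> * of_real t" "t \<ge> 0" "x0 = \<omega> * of_real (cmod x0)" "y0 = \<i> * \<omega> * of_real (cmod y0)" "cmod \<omega> = 1"
  proof -
    have "cmod (X (2 * n)) = snd (bound n)" "cmod (Y (2 * n)) = fst (bound n)" for n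
      using imaginary_axis[OF that(1-4), of n] that(5) B.nonneg[of n] by (simp_all add: norm_mult)
    then have "(\<lambda>n. cmod (X (2 * n))) = B.v" "(\<lambda>n. cmod (Y (2 * n))) = B.u" by auto
    then show ?thesis
      using LIMSEQ_unique[OF tendsto_norm[OF X]] LIMSEQ_unique[OF tendsto_norm[OF Y]] B.tendsto
      unfolding L_def by auto
  qed
qed

end

context symmetric_jacobi
begin

lemma recurrence_solution_P: "recurrence_solution a b z 0 (-1) (\<lambda>n. orth_poly a b n z)"
  by unfold_locales (simp_all add: a_zero)

lemma recurrence_solution_Q: "recurrence_solution a b z 1 0 (\<lambda>n. second_kind_poly a b n z)"
  by unfold_locales (simp_all add: a_zero)

lemma max_modulus_nevanlinna:
  assumes summable: "summable (\<lambda>k. (p (2 * k))\<^sup>2)" "summable (\<lambda>k. (q (Suc (2 * k)))\<^sup>2)" and t: "t > 0"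
  defines "L \<equiv> \<lambda>s. ladder_limits_at (\<lambda>k. (p (2 * k))\<^sup>2) (\<lambda>k. (q (Suc (2 * k)))\<^sup>2) s t"
  shows "max_modulus (nevanlinna_A a b) t = fst (L (0, 1))"
    "max_modulus (nevanlinna_B a b) t = fst (L (1, 0))"
    "max_modulus (nevanlinna_C a b) t = snd (L (0, 1))"
    "max_modulus (nevanlinna_D a b) t = snd (L (1, 0))"
proof -
  have at0: "orth_poly a b n (0 :: complex) = of_real (p n)"
    "second_kind_poly a b n (0 :: complex) = of_real (q n)" for n
    using orth_poly_of_real[of a b n 0] second_kind_poly_of_real[of a b n 0] by simp_all
  let ?w = "\<i> * complex_of_real t"
  have w: "cmod ?w = t" "?w \<noteq> 0" using t by (simp_all add: norm_mult)
  note P = recurrence_solution.limits[OF recurrence_solution_P _ summable]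
  note Q = recurrence_solution.limits[OF recurrence_solution_Q _ summable]
  have nz: "z \<noteq> 0" if "cmod z = t" for z using that t by auto
  show "max_modulus (nevanlinna_A a b) t = fst (L (0, 1))"
    by (rule max_modulus_eqI[where w = ?w])
      (use Q(2)[OF nz] Q(3)[OF w(2), of t 1] w t in \<open>simp_all add: nevanlinna_A_def at0 L_def\<close>)
  show "max_modulus (nevanlinna_B a b) t = fst (L (1, 0))"
    by (rule max_modulus_eqI[where w = ?w])
      (use P(2)[OF nz] P(3)[OF w(2), of t \<i>] w t in \<open>simp_all add: nevanlinna_B_def at0 L_def\<close>)
  show "max_modulus (nevanlinna_C a b) t = snd (L (0, 1))"
    by (rule max_modulus_eqI[where w = ?w])
      (use Q(1)[OF nz] Q(3)[OF w(2), of t 1] w t in \<open>simp_all add: nevanlinna_C_def at0 L_def\<close>)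
  show "max_modulus (nevanlinna_D a b) t = snd (L (1, 0))"
    by (rule max_modulus_eqI[where w = ?w])
      (use P(1)[OF nz] P(3)[OF w(2), of t \<i>] w t in \<open>simp_all add: nevanlinna_D_def at0 L_def\<close>)
qed

lemma p_nonzero: "p (2 * k) \<noteq> 0"
  using wronskian[of "2 * k"] by (auto simp: q_even)

lemma q_nonzero: "q (Suc (2 * k)) \<noteq> 0"
  using wronskian[of "2 * k"] by (auto simp: q_even)

lemma indeterminateI:
  assumes "summable (\<lambda>k. (p (2 * k))\<^sup>2)" "summable (\<lambda>k. (q (Suc (2 * k)))\<^sup>2)"
  shows "indeterminate_problem a b"
  unfolding indeterminate_problem_def
proof (rule summableI_nonneg_bounded)
  let ?f = "\<lambda>n. (p n)\<^sup>2 + (q n)\<^sup>2" and ?K = "(\<Sum>k. (p (2 * k))\<^sup>2) + (\<Sum>k. (q (Suc (2 * k)))\<^sup>2)"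
  fix n
  have "(\<Sum>k<2 * n. ?f k) = (\<Sum>k<n. (p (2 * k))\<^sup>2) + (\<Sum>k<n. (q (Suc (2 * k)))\<^sup>2)"
    by (induction n) (simp_all add: p_odd q_even)
  also have "\<dots> \<le> ?K" using assms by (intro add_mono sum_le_suminf) auto
  finally have "(\<Sum>k<2 * n. ?f k) \<le> ?K" .
  moreover have "(\<Sum>k<n. ?f k) \<le> (\<Sum>k<2 * n. ?f k)" by (rule sum_mono2) auto
  ultimately show "(\<Sum>k<n. ?f k) \<le> ?K" by linarith
qed simp

end

section \<open>Power-law Jacobi parameters\<close>

text \<open>This is a partial product of Wallis type.  Its factors
  \<open>(2 * m / (2 * m + 1))\<^sup>2\<close> lie between
  \<open>(m - 1 / 2) / (m + 1 / 2)\<close> and \<open>m / (m + 1)\<close>.  So multiplication by \<open>k + 1\<close>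
  makes the product decreasing and multiplication by \<open>k + 1 / 2\<close> makes it increasing,
  which keeps the limit positive.\<close>

lemma wallis_square_limit:
  fixes g :: "nat \<Rightarrow> real"
  defines "g \<equiv> \<lambda>k. \<Prod>j<k. (2 * real (Suc j) / (2 * real (Suc j) + 1))\<^sup>2"
  shows "\<exists>L>0. (\<lambda>k. real (Suc k) * g k) \<longlonglongrightarrow> L"
proof -
  define s where "s k = real (Suc k) * g k" for k
  define t where "t k = (real (Suc k) - 1 / 2) * g k" for k
  have g_pos: "0 < g k" for k unfolding g_def by (intro prod_pos) simp
  have g_Suc: "g (Suc k) = (2 * real (Suc k) / (2 * real (Suc k) + 1))\<^sup>2 * g k" for k
    by (simp add: g_def mult.commute)
  have "s (Suc k) \<le> s k" for k
  proof -
    have "real (Suc (Suc k)) * (2 * real (Suc k) / (2 * real (Suc k) + 1))\<^sup>2 \<le> real (Suc k)"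
      by (simp add: power2_eq_square divide_simps) (simp add: algebra_simps)
    from mult_right_mono[OF this less_imp_le[OF g_pos[of k]]] show ?thesis
      by (simp add: s_def g_Suc mult.assoc)
  qed
  then have "decseq s" by (rule decseq_SucI)
  have "t k \<le> t (Suc k)" for k
  proof -
    have "real (Suc k) - 1 / 2 \<le> (real (Suc (Suc k)) - 1 / 2) * (2 * real (Suc k) / (2 * real (Suc k) + 1))\<^sup>2"
      by (simp add: power2_eq_square divide_simps) (simp add: algebra_simps)
    from mult_right_mono[OF this less_imp_le[OF g_pos[of k]]] show ?thesis
      by (simp add: t_def g_Suc mult.assoc)
  qed
  then have "incseq t" by (rule incseq_SucI)
  have lower: "1 / 2 \<le> s k" for k
  proof -
    have "1 / 2 = t 0" by (simp add: t_def g_def)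
    also have "\<dots> \<le> t k" using \<open>incseq t\<close> by (rule incseqD) simp
    also have "\<dots> \<le> s k" using g_pos[of k] by (simp add: t_def s_def mult_right_mono)
    finally show ?thesis .
  qed
  then obtain L where L: "s \<longlonglongrightarrow> L" using decseq_convergent[OF \<open>decseq s\<close>] by blast
  have "1 / 2 \<le> L" using lower by (intro LIMSEQ_le_const[OF L]) auto
  then show ?thesis using L unfolding s_def by (intro exI[of _ L]) auto
qed

lemma square_powr: "x \<ge> 0 \<Longrightarrow> (x\<^sup>2) powr c = (x powr c)\<^sup>2" for x c :: real
  by (simp add: power2_eq_square powr_mult)

locale power_jacobi = symmetric_jacobi +
  fixes c :: real
  assumes c: "c > 1" and b_eq: "\<And>n. n \<ge> 1 \<Longrightarrow> b n = real n powr c"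
begin

lemma p_square_Suc:
  "(p (2 * Suc k))\<^sup>2 = (b 0)\<^sup>2 * (\<Prod>j<k. (2 * real (Suc j) / (2 * real (Suc j) + 1))\<^sup>2) powr c"
proof (induction k)
  case 0
  have "p 2 = - b 0"
    using at_zero_Suc_Suc(1)[of 0] b_eq[of 1] by (simp add: numeral_2_eq_2 del: orth_poly.simps(3))
  then show ?case by simp
next
  case (Suc k)
  let ?m = "2 * Suc k"
  have solve: "x = - (s / t) * y" if "t * x = - s * y" "t > 0" for x y s t :: real
    using that by (simp add: field_simps)
  have "2 * Suc (Suc k) = Suc (Suc ?m)" by simp
  then have "p (2 * Suc (Suc k)) = - (b ?m / b (Suc ?m)) * p ?m"
    by (simp only: solve[OF at_zero_Suc_Suc(1)[of ?m] b_pos])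
  then have "(p (2 * Suc (Suc k)))\<^sup>2 = (b ?m / b (Suc ?m))\<^sup>2 * (p ?m)\<^sup>2"
    by (simp only: power_mult_distrib power2_minus)
  also have "b ?m / b (Suc ?m) = (2 * real (Suc k) / (2 * real (Suc k) + 1)) powr c"
    by (simp add: b_eq powr_divide)
  also have "\<dots>\<^sup>2 = ((2 * real (Suc k) / (2 * real (Suc k) + 1))\<^sup>2) powr c"
    by (rule square_powr[symmetric]) simp
  finally show ?case unfolding Suc by (simp add: powr_mult prod_nonneg mult_ac del: of_nat_Suc)
qed

text \<open>The value of \<open>A\<close> involves \<open>b 0\<close>, but the Wronskian relation
  \<open>b (2 * k) * p (2 * k) * q (2 * k + 1) = 1\<close> fixes the product \<open>A * B = 4 powr - c\<close>.
  This is why the order and the type do not depend on \<open>b 0\<close>.\<close>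

lemma coefficient_asymptotics:
  "\<exists>A>0. \<exists>B>0. sqrt (A * B) = 2 powr - c \<and>
     (\<lambda>k. (p (2 * k))\<^sup>2 * real (Suc k) powr c) \<longlonglongrightarrow> A \<and>
     (\<lambda>k. (q (Suc (2 * k)))\<^sup>2 * real (Suc k) powr c) \<longlonglongrightarrow> B"
proof -
  define g where "g k = (\<Prod>j<k. (2 * real (Suc j) / (2 * real (Suc j) + 1))\<^sup>2)" for k
  have g: "g k > 0" for k unfolding g_def by (intro prod_pos) simp
  obtain L where L: "L > 0" "(\<lambda>k. real (Suc k) * g k) \<longlonglongrightarrow> L"
    using wallis_square_limit unfolding g_def by blast
  define A where "A = (b 0)\<^sup>2 * L powr c"
  have A: "A > 0" using b_pos[of 0] L by (simp add: A_def)
  have "(\<lambda>k. (p (2 * Suc k))\<^sup>2 * real (Suc (Suc k)) powr c) \<longlonglongrightarrow> A"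
  proof -
    have ratio: "(\<lambda>k. real (Suc (Suc k)) / real (Suc k)) \<longlonglongrightarrow> 1" by real_asymp
    have "(p (2 * Suc k))\<^sup>2 * real (Suc (Suc k)) powr c =
        (b 0)\<^sup>2 * ((real (Suc k) * g k) * (real (Suc (Suc k)) / real (Suc k))) powr c" for k
      using g[of k] unfolding p_square_Suc g_def[symmetric] by (simp add: powr_mult[symmetric])
    moreover have "(\<lambda>k. (b 0)\<^sup>2 * ((real (Suc k) * g k) * (real (Suc (Suc k)) / real (Suc k))) powr c) \<longlonglongrightarrow>
        (b 0)\<^sup>2 * (L * 1) powr c"
      using L by (intro tendsto_intros ratio) auto
    ultimately show ?thesis by (simp add: A_def)
  qed
  then have p_lim: "(\<lambda>k. (p (2 * k))\<^sup>2 * real (Suc k) powr c) \<longlonglongrightarrow> A"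
    by (rule LIMSEQ_imp_Suc)
  define B where "B = (1 / 4) powr c / A"
  have q_sq: "(q (Suc (2 * k)))\<^sup>2 * real (Suc k) powr c =
      ((real (Suc k) / (2 * real k))\<^sup>2) powr c / ((p (2 * k))\<^sup>2 * real (Suc k) powr c)" if k: "k \<ge> 1" for k
  proof -
    have "b (2 * k) * (p (2 * k) * q (Suc (2 * k))) = 1" using wronskian[of "2 * k"] by (simp add: q_even)
    then have "q (Suc (2 * k)) = 1 / ((2 * real k) powr c * p (2 * k))"
      using k p_nonzero[of k] by (simp add: b_eq field_simps)
    then have q: "(q (Suc (2 * k)))\<^sup>2 = 1 / ((2 * real k) powr c * p (2 * k))\<^sup>2"
      by (simp add: power_divide)
    have "((real (Suc k) / (2 * real k))\<^sup>2) powr c = (real (Suc k) powr c)\<^sup>2 / ((2 * real k) powr c)\<^sup>2"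
      by (subst square_powr) (auto simp: powr_divide power_divide)
    then show ?thesis
      unfolding q using k p_nonzero[of k] by (simp add: power2_eq_square field_simps del: of_nat_Suc)
  qed
  have "(\<lambda>k. ((real (Suc k) / (2 * real k))\<^sup>2) powr c / ((p (2 * k))\<^sup>2 * real (Suc k) powr c)) \<longlonglongrightarrow> B"
  proof -
    have "(\<lambda>k. (real (Suc k) / (2 * real k))\<^sup>2) \<longlonglongrightarrow> 1 / 4"
    proof -
      have "(\<lambda>k. real (Suc k) / (2 * real k)) \<longlonglongrightarrow> 1 / 2" by real_asymp
      from tendsto_power[OF this, of 2] show ?thesis by (simp add: power_divide)
    qed
    then show ?thesis unfolding B_def using A by (intro tendsto_intros p_lim) auto
  qed
  then have q_lim: "(\<lambda>k. (q (Suc (2 * k)))\<^sup>2 * real (Suc k) powr c) \<longlonglongrightarrow> B"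
    by (rule Lim_transform_eventually)
      (rule eventually_mono[OF eventually_ge_at_top[of 1]], rule q_sq[symmetric])
  have "sqrt (A * B) = sqrt ((1 / 4) powr c)" using A by (simp add: B_def)
  also have "(1 / 4) powr c = (2 powr - c)\<^sup>2"
    using powr_mult[of 2 2 c] by (simp add: powr_divide powr_minus power2_eq_square field_simps)
  finally have "sqrt (A * B) = 2 powr - c" by simp
  moreover have "B > 0" using A by (simp add: B_def)
  ultimately show ?thesis using A p_lim q_lim by blast
qed

lemma coefficients_summable: "summable (\<lambda>k. (p (2 * k))\<^sup>2)" "summable (\<lambda>k. (q (Suc (2 * k)))\<^sup>2)"
proof -
  have summable: "summable f" if f: "(\<lambda>k. f k * real (Suc k) powr c) \<longlonglongrightarrow> l" "\<And>k. 0 \<le> f k" for f :: "nat \<Rightarrow> real" and l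
  proof (rule summable_comparison_test_ev)
    have "\<forall>\<^sub>F k in sequentially. f k * real (Suc k) powr c < l + 1"
      using order_tendstoD(2)[OF f(1)] by simp
    then show "\<forall>\<^sub>F k in sequentially. norm (f k) \<le> (l + 1) * power_coeff c k"
    proof eventually_elim
      case (elim k)
      then have "f k \<le> (l + 1) * power_coeff c k"
        by (simp add: power_coeff_def powr_minus field_simps del: of_nat_Suc)
      then show ?case using f(2)[of k] by simp
    qed
    show "summable (\<lambda>k. (l + 1) * power_coeff c k)" by (intro summable_mult summable_power_coeff c)
  qed
  obtain A B where "(\<lambda>k. (p (2 * k))\<^sup>2 * real (Suc k) powr c) \<longlonglongrightarrow> A"
    "(\<lambda>k. (q (Suc (2 * k)))\<^sup>2 * real (Suc k) powr c) \<longlonglongrightarrow> B"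
    using coefficient_asymptotics by blast
  from summable[OF this(1)] summable[OF this(2)]
  show "summable (\<lambda>k. (p (2 * k))\<^sup>2)" "summable (\<lambda>k. (q (Suc (2 * k)))\<^sup>2)"
    by simp_all
qed

text \<open>The argument of the model is scaled by \<open>2 powr - c\<close>, and \<open>(2 powr - c) powr (1 / c) = 1 / 2\<close>
  is the factor in the type.\<close>

lemma nevanlinna_growth:
  defines "T \<equiv> exp_type (1 / c) (\<lambda>y. fst (model_limits c y))"
  assumes f: "f \<in> {nevanlinna_A a b, nevanlinna_B a b, nevanlinna_C a b, nevanlinna_D a b}"
  shows "growth_order f = ereal (1 / c) \<and> growth_type f = ereal (1 / 2) * T"
proof -
  let ?\<alpha> = "\<lambda>k. (p (2 * k))\<^sup>2" and ?\<beta> = "\<lambda>k. (q (Suc (2 * k)))\<^sup>2"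
  obtain A B where AB: "A > 0" "B > 0" "sqrt (A * B) = 2 powr - c"
    "(\<lambda>k. ?\<alpha> k * real (Suc k) powr c) \<longlonglongrightarrow> A" "(\<lambda>k. ?\<beta> k * real (Suc k) powr c) \<longlonglongrightarrow> B"
    using coefficient_asymptotics by blast
  let ?L = "\<lambda>s y. ladder_limits_at ?\<alpha> ?\<beta> s y"
  note max_eq = max_modulus_nevanlinna[OF coefficients_summable]
  have "\<exists>s F. (s = (1, 0) \<or> s = (0, 1)) \<and>
      (F = (\<lambda>y. fst (?L s y)) \<or> F = (\<lambda>y. snd (?L s y))) \<and> (\<forall>t>0. max_modulus f t = F t)"
  proof -
    from f consider "f = nevanlinna_A a b" | "f = nevanlinna_B a b"
      | "f = nevanlinna_C a b" | "f = nevanlinna_D a b" by blast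
    then show ?thesis
    proof cases
      case 1
      show ?thesis unfolding 1
        by (rule exI[of _ "(0, 1)"], rule exI[of _ "\<lambda>y. fst (?L (0, 1) y)"]) (simp add: max_eq(1))
    next
      case 2
      show ?thesis unfolding 2
        by (rule exI[of _ "(1, 0)"], rule exI[of _ "\<lambda>y. fst (?L (1, 0) y)"]) (simp add: max_eq(2))
    next
      case 3
      show ?thesis unfolding 3
        by (rule exI[of _ "(0, 1)"], rule exI[of _ "\<lambda>y. snd (?L (0, 1) y)"]) (simp add: max_eq(3))
    next
      case 4
      show ?thesis unfolding 4
        by (rule exI[of _ "(1, 0)"], rule exI[of _ "\<lambda>y. snd (?L (1, 0) y)"]) (simp add: max_eq(4))
    qed
  qed
  then obtain s F where s: "s = (1, 0) \<or> s = (0, 1)"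
    and F: "F = (\<lambda>y. fst (?L s y)) \<or> F = (\<lambda>y. snd (?L s y))"
    and max: "\<And>t. t > 0 \<Longrightarrow> max_modulus f t = F t"
    by blast
  have fam: "ladder_family ?\<alpha> ?\<beta> s"
    using s coefficients_summable p_nonzero q_nonzero by unfold_locales auto
  let ?H = "\<lambda>y. fst (model_limits c y)"
  have dom: "growth_dominated F (\<lambda>y. ?H (2 powr - c * y))" "growth_dominated (\<lambda>y. ?H (2 powr - c * y)) F"
    using ladder_growth[OF c fam AB(1,4) AB(2,5) F] unfolding AB(3) by blast+
  have c': "1 / c > 0" using c by simp
  have ordH: "exp_order (1 / c) (\<lambda>y. ?H (2 powr - c * y))"
    by (rule exp_order_scale[OF model_exp_order[OF c]]) simp
  have ord: "exp_order (1 / c) F" by (rule exp_order_similar[OF ordH dom c'])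
  have "growth_type f = exp_type (1 / c) F" by (rule growth_order_type_eq(2)[OF max ord c'])
  also have "\<dots> = exp_type (1 / c) (\<lambda>y. ?H (2 powr - c * y))" by (rule exp_type_similar[OF ordH dom c'])
  also have "\<dots> = ereal ((2 powr - c) powr (1 / c)) * T"
    unfolding T_def by (rule exp_type_scale) simp
  also have "(2 powr - c) powr (1 / c) = (1 / 2 :: real)"
    using c by (simp only: powr_powr) (simp add: powr_minus_divide)
  finally show ?thesis using growth_order_type_eq(1)[OF max ord c'] by simp
qed

end

theorem theorem1p11:
  fixes c :: real and a b :: "nat \<Rightarrow> real"
  assumes "c > 1"
    and "symmetric_problem a"
    and "b 0 > 0"
    and "\<forall>n\<ge>1. b n = real n powr c"
  shows "indeterminate_problem a b \<and>
         problem_has_order a b (ereal (1 / c)) \<and>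
         (\<exists>T. growth_type (G_fun (2 * c)) = T \<and> growth_type (Z_fun (2 * c)) = T \<and>
              problem_has_type a b (T / 2))"
proof -
  have "b n > 0" for n using assms(3,4) by (cases n) auto
  then interpret power_jacobi a b c
    using assms by unfold_locales (auto simp: symmetric_problem_def)
  let ?T = "exp_type (1 / c) (\<lambda>y. fst (model_limits c y))"
  have half: "ereal (1 / 2) * t = t / 2" for t
    by (cases t) (auto simp: divide_ereal_def mult.commute)
  have "indeterminate_problem a b" by (rule indeterminateI[OF coefficients_summable])
  moreover have "problem_has_order a b (ereal (1 / c))" "problem_has_type a b (?T / 2)"
    unfolding problem_has_order_def problem_has_type_def half[symmetric]
    using nevanlinna_growth by blast+
  ultimately show ?thesis using growth_G[OF assms(1)] growth_Z[OF assms(1)] by blast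
qed

end
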